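(* Let $\{X_t\}_{t\in\mathbb N}$ be the simple random walk, started at $X_0=x_0\in V_0$, on an increasing sequence $\{\mathbb G_t\}$ of finite connected subgraphs of $\mathbb G_\infty$. Let $\{t_l\}_{l\in\mathbb N}$ be an increasing sequence of integers with $t_0=0$, and let $\{\mathbb K_l\}_{l\in\mathbb N}$, $\{\mathbb K^l\}_{l\in\mathbb N}$ be two sequences of increasing connected finite subgraphs of $\mathbb G_\infty$, such that: (a) $\mathbb K^{l-1}\subseteq\mathbb K_l\subseteq\mathbb K^l$ for all $l$; the edge sets of $\mathbb K_l,\mathbb K^l$ are induced from $\mathbb G_\infty$; and for $t_l\le t<t_{l+1}$ the graph is frozen: $\mathbb K_l\subseteq\mathbb G_t=\mathbb G_{t_l}\subseteq\mathbb K^l$. (b) For some constant $c_{\mathrm{RN}}>0$ and all $l$, $x,y\in\mathbb K^{l-1}$, $z\in\partial\mathbb K_l$, $$c_{\mathrm{RN}}\le\frac{\mathbb P_x(X_{\tau_{\mathbb K_l}}=z)}{\mathbb P_y(X_{\tau_{\mathbb K_l}}=z)}\le c_{\mathrm{RN}}^{-1},$$ and the volume of $\mathbb K_l$ is of exponential growth in $l$: $\liminf_{l\to\infty}\{l^{-1}\log v(\mathbb K_l)\}>0$. (c) For some positive $\epsilon$ and $c_E=c_E(\epsilon)$, and all $l\in\mathbb N$, $s\ge1$, $$\sup_{x\in\mathbb K_l}\mathbb P_x\Big(\tau_{\mathbb K_l}>\frac{s\,v(\mathbb K_l)}{(\log v(\mathbb K_l))^{2+\epsilon}}\Big)<c_E^{-1}e^{-c_Es}.$$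 Assume further that $\pi^{(t)}(x,x)\ge1$ and $\pi^{(t)}(x)\le\Delta$ for some constant $\Delta$ and all $t\in\mathbb N$, $x\in V_t$. If $$\sum_{t=0}^\infty\frac1{v(t)}=\sum_{l=0}^\infty\frac{t_{l+1}-t_l}{v(t_l)}=\infty,$$ then $\{X_t\}$ is (weak) recurrent.
   Context: Here $\mathbb N=\{0,1,2,\dots\}$; conditions involving $\mathbb K^{l-1}$ are imposed for $l\ge1$. $\mathbb G_\infty=(V,E)$ is an infinite, locally finite, connected graph, with multiple edges and self-loops allowed. $\mathbb G_t=(V,E_t)$, $t\in\mathbb N$, are subgraphs with $E_t\subseteq E_{t+1}\subseteq\cdots\subseteq E$. $V_t:=\{x\in V:\exists y\in V,\ y\ne x,\ (x,y)\in E_t\}$ is the set of non-isolated vertices at time $t$; $\mathbb G_t$ is identified with $(V_t,E_t)$, and it is assumed throughout that every $\mathbb G_t$, $t<\infty$, is connected and finite ($|V_t|<\infty$). For $x,y\in V_t$, $\pi^{(t)}(x,y)$ is the number of (multiple) edges of $E_t$ between $x$ and $y$, with $\pi^{(t)}(x,x)$ counting self-loops at $x$; $\pi^{(t)}(x)=\sum_{y\in V_t}\pi^{(t)}(x,y)$, $\pi^{(t)}(A)=\sum_{x\in A}\pi^{(t)}(x)$ for $A\subseteq V_t$, and $\pi^{(\infty)}$ denotes the same quantities for $\mathbb G_\infty$. The volume is $v(t):=\pi^{(t)}(V_t)$. The simple random walk $\{X_t\}$ on $\{\mathbb G_t\}$ is the time-inhomogeneous Markov chain with $\mathbb P(X_{t+1}=y\mid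 X_t=x)=\pi^{(t)}(x,y)/\pi^{(t)}(x)$, $x,y\in V_t$. The edge set of a subgraph $\mathbb H\subseteq\mathbb G_\infty$ is induced from $\mathbb G_\infty$ if for all $x,y\in\mathbb H$, every edge $(x,y)\in E$ belongs to $E(\mathbb H)$; in that case $v(\mathbb H):=\pi^{(\infty)}(\mathbb H)$, the sum of $\pi^{(\infty)}(x)$ over vertices $x$ of $\mathbb H$. The inner boundary of $\mathbb H$ relative to $\mathbb G_\infty$ is $\partial\mathbb H:=\{x\in\mathbb H:\exists y\in\mathbb G_\infty\setminus\mathbb H,\ (x,y)\in E\}$, and $\tau_{\mathbb H}:=\inf\{t\ge0: X_t\in\partial\mathbb H\}$ is the first hitting time of $\partial\mathbb H$. In (b) and (c), $\mathbb P_x$ refers to simple random walk on $\mathbb G_\infty$ started at $x$ (up to time $\tau_{\mathbb K_l}$, when started in $\mathbb K_l$, it only uses edges of $\mathbb K_l$). The ratio bound in (b) is read as $c_{\mathrm{RN}}\mathbb P_y(\cdot)\le\mathbb P_x(\cdot)\le c_{\mathrm{RN}}^{-1}\mathbb P_y(\cdot)$ when probabilities vanish. $\{X_t\}$ with $X_0=x_0$ is called (weak) recurrent if $\mathbb E_{x_0}[N_0]=\infty$, where $N_0:=\sum_{t=0}^\infty1_{\{X_t=x_0\}}$. *)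

theory Defs
  imports "HOL-Probability.Probability" "HOL-Library.Uprod"
begin

(* Undirected multigraphs: edges are named, so parallel edges are distinct edges with the same
   ends, and a self-loop at x is an edge with ends "Upair x x". *)
record ('v, 'e) multigraph =
  verts :: "'v set"
  edges :: "'e set"
  ends :: "'e \<Rightarrow> 'v uprod"

definition wf_graph :: "('v, 'e) multigraph \<Rightarrow> bool" where
  "wf_graph G \<longleftrightarrow> (\<forall>e\<in>edges G. set_uprod (ends G e) \<subseteq> verts G)"

definition adjacent :: "('v, 'e) multigraph \<Rightarrow> 'v \<Rightarrow> 'v \<Rightarrow> bool" where
  "adjacent G x y \<longleftrightarrow> (\<exists>e\<in>edges G. ends G e = Upair x y)"

definition graph_connected :: "('v, 'e) multigraph \<Rightarrow> bool" where
  "graph_connected G \<longleftrightarrow>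
     verts G \<noteq> {} \<and> (\<forall>x\<in>verts G. \<forall>y\<in>verts G. (adjacent G)\<^sup>*\<^sup>* x y)"

definition locally_finite :: "('v, 'e) multigraph \<Rightarrow> bool" where
  "locally_finite G \<longleftrightarrow> (\<forall>x\<in>verts G. finite {e \<in> edges G. x \<in> set_uprod (ends G e)})"

(* All graphs compared here share one total incidence map; its values off the edge set are
   irrelevant. *)
definition subgraph :: "('v, 'e) multigraph \<Rightarrow> ('v, 'e) multigraph \<Rightarrow> bool" where
  "subgraph H G \<longleftrightarrow>
     wf_graph H \<and> verts H \<subseteq> verts G \<and> edges H \<subseteq> edges G \<and> ends H = ends G"

definition edges_induced :: "('v, 'e) multigraph \<Rightarrow> ('v, 'e) multigraph \<Rightarrow> bool" where
  "edges_induced H G \<longleftrightarrow>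
     (\<forall>x\<in>verts H. \<forall>y\<in>verts H. \<forall>e\<in>edges G. ends G e = Upair x y \<longrightarrow> e \<in> edges H)"

definition inner_boundary :: "('v, 'e) multigraph \<Rightarrow> ('v, 'e) multigraph \<Rightarrow> 'v set" where
  "inner_boundary G H = {x \<in> verts H. \<exists>y \<in> verts G - verts H. adjacent G x y}"

definition edge_mult :: "('v, 'e) multigraph \<Rightarrow> 'v \<Rightarrow> 'v \<Rightarrow> nat" where
  "edge_mult G x y = card {e \<in> edges G. ends G e = Upair x y}"

(* Restricted to the neighbours of x, finitely many in a locally finite graph: a sum over all of
   an infinite vertex set would be 0 by convention.  A self-loop counts once. *)
definition deg :: "('v, 'e) multigraph \<Rightarrow> 'v \<Rightarrow> nat" where
  "deg G x = (\<Sum>y | y \<in> verts G \<and> edge_mult G x y \<noteq> 0. edge_mult G x y)"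

definition vol :: "('v, 'e) multigraph \<Rightarrow> 'v set \<Rightarrow> nat" where
  "vol G A = (\<Sum>x\<in>A. deg G x)"

(* The subgraph of G with edge set F, reduced to its non-isolated vertices.  A vertex whose only
   edges in F are self-loops counts as isolated, so those loops are dropped too. *)
definition snapshot :: "('v, 'e) multigraph \<Rightarrow> 'e set \<Rightarrow> ('v, 'e) multigraph" where
  "snapshot G F =
     (let V = {x \<in> verts G. \<exists>y \<in> verts G. y \<noteq> x \<and> (\<exists>e\<in>F. ends G e = Upair x y)}
      in \<lparr>verts = V, edges = {e \<in> F. set_uprod (ends G e) \<subseteq> V}, ends = ends G\<rparr>)"

definition srw_step :: "('v, 'e) multigraph \<Rightarrow> 'v \<Rightarrow> 'v \<Rightarrow> real" where
  "srw_step G x y = real (edge_mult G x y) / real (deg G x)"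

(* The Markov property is written multiplicatively, so that histories of probability 0 impose no
   condition. *)
definition markov_chain_from ::
  "'w measure \<Rightarrow> (nat \<Rightarrow> 'w \<Rightarrow> 'v) \<Rightarrow> 'v set \<Rightarrow> (nat \<Rightarrow> 'v \<Rightarrow> 'v \<Rightarrow> real) \<Rightarrow> 'v \<Rightarrow> bool" where
  "markov_chain_from M X S p x \<longleftrightarrow>
     prob_space M \<and>
     (\<forall>t. X t \<in> measurable M (count_space S)) \<and>
     (AE \<omega> in M. X 0 \<omega> = x) \<and>
     (\<forall>t \<xi> y. measure M {\<omega> \<in> space M. (\<forall>s\<le>t. X s \<omega> = \<xi> s) \<and> X (Suc t) \<omega> = y} =
              measure M {\<omega> \<in> space M. \<forall>s\<le>t. X s \<omega> = \<xi> s} * p t (\<xi> t) y)"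

(* Infinite if the path never enters B. *)
definition hitting_time :: "'v set \<Rightarrow> (nat \<Rightarrow> 'v) \<Rightarrow> enat" where
  "hitting_time B \<xi> = Inf (enat ` {t. \<xi> t \<in> B})"

definition num_visits :: "'v \<Rightarrow> (nat \<Rightarrow> 'v) \<Rightarrow> ennreal" where
  "num_visits x \<xi> = (\<Sum>t. if \<xi> t = x then 1 else 0)"

definition weakly_recurrent :: "'w measure \<Rightarrow> (nat \<Rightarrow> 'w \<Rightarrow> 'v) \<Rightarrow> 'v \<Rightarrow> bool" where
  "weakly_recurrent M X x \<longleftrightarrow> (\<integral>\<^sup>+ \<omega>. num_visits x (\<lambda>t. X t \<omega>) \<partial>M) = \<infinity>"

end

theory Submission
  imports Defs
begin

text \<open>
  Fix a frozen phase of length \<open>n\<close> on a graph \<open>H\<close> of volume \<open>v\<close>, and let \<open>u\<^sub>y\<close> be the expected number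
  of visits to \<open>x\<^sub>0\<close> within the phase, when it starts at \<open>y\<close>. Reversibility, Cauchy--Schwarz and the
  self-loops make every return probability on \<open>H\<close> at least \<open>1 / v\<close>. Let \<open>m\<close> be of order
  \<open>v(K) / (ln v(K))\<^sup>1\<^sup>+\<^sup>\<epsilon>\<close>, so that the walk leaves \<open>K = K\<^sub>l\<close> before time \<open>m\<close> up to probability
  \<open>\<delta> = O(v(K)\<^sup>-\<^sup>2)\<close>. Started at \<open>x\<^sub>0\<close>, the expected number \<open>A \<ge> (n - 2 m) / v\<close> of visits during
  \<open>[m, n - m)\<close> is, up to \<open>\<delta> (m + A)\<close>, collected after the exit from \<open>K\<close>, and the comparability of
  exit laws transfers it to any start \<open>y\<close> in the previous \<open>K\<^sup>l\<^sup>-\<^sup>1\<close>. The error is measured relative to \<open>A\<close>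
  and not to \<open>n\<close>, because \<open>v\<close> is not bounded in terms of \<open>v(K)\<close>. Hence
  \<open>u\<^sub>y \<ge> c n / v - C m / v(K) - C \<delta> m\<close>, where both error terms are summable over the phases by the
  exponential growth of \<open>v(K\<^sub>l)\<close>.
\<close>

subsection \<open>Finite Markov kernels\<close>

locale finite_markov_kernel =
  fixes V :: "'a set" and p :: "'a \<Rightarrow> 'a \<Rightarrow> real"
  assumes fin: "finite V"
    and nonneg: "\<And>x y. p x y \<ge> 0"
    and stochastic: "\<And>x. x \<in> V \<Longrightarrow> (\<Sum>y\<in>V. p x y) = 1"
begin

fun kpow :: "nat \<Rightarrow> 'a \<Rightarrow> 'a \<Rightarrow> real" where
  "kpow 0 x y = of_bool (x = y)"
| "kpow (Suc k) x y = (\<Sum>z\<in>V. p x z * kpow k z y)"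

lemma kpow_nonneg: "kpow k x y \<ge> 0"
  by (induction k arbitrary: x) (auto intro!: sum_nonneg mult_nonneg_nonneg nonneg)

lemma kpow_sum: "x \<in> V \<Longrightarrow> (\<Sum>y\<in>V. kpow k x y) = 1"
proof (induction k arbitrary: x)
  case 0
  then show ?case by (simp add: of_bool_def fin)
next
  case (Suc k)
  have "(\<Sum>y\<in>V. kpow (Suc k) x y) = (\<Sum>z\<in>V. p x z * (\<Sum>y\<in>V. kpow k z y))"
    by (simp add: sum_distrib_left) (rule sum.swap)
  also have "\<dots> = 1"
    using Suc by (simp add: stochastic)
  finally show ?case .
qed

lemma kpow_le_1: "x \<in> V \<Longrightarrow> y \<in> V \<Longrightarrow> kpow k x y \<le> 1"
  using member_le_sum[of y V "kpow k x"] kpow_nonneg fin kpow_sum by simp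

lemma kpow_add: "x \<in> V \<Longrightarrow> kpow (j + k) x y = (\<Sum>z\<in>V. kpow j x z * kpow k z y)"
proof (induction j arbitrary: x)
  case 0
  have "(\<Sum>z\<in>V. kpow 0 x z * kpow k z y) = (\<Sum>z\<in>V. if x = z then kpow k z y else 0)"
    by (rule sum.cong) auto
  then show ?case using 0 fin by simp
next
  case (Suc j)
  have "kpow (Suc j + k) x y = (\<Sum>w\<in>V. p x w * (\<Sum>z\<in>V. kpow j w z * kpow k z y))"
    using Suc.IH by simp
  also have "\<dots> = (\<Sum>w\<in>V. \<Sum>z\<in>V. p x w * kpow j w z * kpow k z y)"
    by (simp add: sum_distrib_left mult.assoc)
  also have "\<dots> = (\<Sum>z\<in>V. \<Sum>w\<in>V. p x w * kpow j w z * kpow k z y)"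
    by (rule sum.swap)
  also have "\<dots> = (\<Sum>z\<in>V. kpow (Suc j) x z * kpow k z y)"
    by (simp add: sum_distrib_right)
  finally show ?case .
qed

lemma kpow_1: "y \<in> V \<Longrightarrow> kpow 1 x y = p x y"
  using fin by (simp add: of_bool_def if_distrib cong: if_cong)

lemma kpow_Suc_right: "x \<in> V \<Longrightarrow> y \<in> V \<Longrightarrow> kpow (Suc k) x y = (\<Sum>z\<in>V. kpow k x z * p z y)"
  using kpow_add[of x k 1 y] kpow_1 by simp

text \<open>The times are \<open>0, ..., n - 1\<close>, so a start at the target counts once. The
  start is the last argument, which makes \<open>visits t n\<close> a function on states that the
  kernel can average.\<close>

definition visits :: "'a \<Rightarrow> nat \<Rightarrow> 'a \<Rightarrow> real" where
  "visits t n x = (\<Sum>k<n. kpow k x t)"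

lemma visits_nonneg: "visits t n x \<ge> 0"
  unfolding visits_def by (intro sum_nonneg kpow_nonneg)

lemma visits_mono: "m \<le> n \<Longrightarrow> visits t m x \<le> visits t n x"
  unfolding visits_def by (intro sum_mono2) (auto simp: kpow_nonneg)

lemma visits_le: "x \<in> V \<Longrightarrow> t \<in> V \<Longrightarrow> visits t n x \<le> real n"
  unfolding visits_def using sum_mono[of "{..<n}" "\<lambda>k. kpow k x t" "\<lambda>_. 1"] kpow_le_1 by simp

lemma visits_Suc: "visits t (Suc n) x = of_bool (x = t) + (\<Sum>z\<in>V. p x z * visits t n z)"
proof -
  have "visits t (Suc n) x = of_bool (x = t) + (\<Sum>k<n. \<Sum>z\<in>V. p x z * kpow k z t)"
    unfolding visits_def by (subst sum.lessThan_Suc_shift) simp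
  then show ?thesis
    unfolding visits_def by (subst (asm) sum.swap) (simp add: sum_distrib_left)
qed

lemma visits_split: "m \<le> n \<Longrightarrow> visits t n x = visits t m x + (\<Sum>k=m..<n. kpow k x t)"
  unfolding visits_def by (metis atLeast0LessThan sum.atLeastLessThan_concat zero_le)

text \<open>Maximum principle: away from \<open>t\<close>, the count with horizon
  \<open>Suc n\<close> is an average of counts with horizon \<open>n\<close>, each at most the one
  from \<open>t\<close>, and that one grows with the horizon.\<close>

lemma visits_maximal: "x \<in> V \<Longrightarrow> visits t n x \<le> visits t n t"
proof (induction n arbitrary: x)
  case 0
  then show ?case by (simp add: visits_def)
next
  case (Suc n)
  show ?case
  proof (cases "x = t")
    case False
    have "visits t (Suc n) x \<le> (\<Sum>z\<in>V. p x z * visits t n t)"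
      unfolding visits_Suc using False Suc.IH nonneg by (auto intro!: sum_mono mult_left_mono)
    also have "\<dots> = visits t n t"
      using Suc.prems by (simp add: sum_distrib_right[symmetric] stochastic)
    also have "\<dots> \<le> visits t (Suc n) t" by (rule visits_mono) simp
    finally show ?thesis .
  qed simp
qed

end

text \<open>Here \<open>\<beta> k w\<close> is the mass at \<open>w\<close>, at time \<open>k\<close>, of the walk started from \<open>y\<close> and killed one
  step after it leaves \<open>I\<close>.\<close>

locale killed_kernel = finite_markov_kernel +
  fixes I B :: "'a set" and y :: 'a and \<beta> :: "nat \<Rightarrow> 'a \<Rightarrow> real"
  assumes disj: "I \<inter> B = {}"
    and sub: "I \<union> B \<subseteq> V"
    and start: "y \<in> I \<union> B"
    and exits: "\<And>x w. x \<in> I \<Longrightarrow> w \<in> V - (I \<union> B) \<Longrightarrow> p x w = 0"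
    and beta_0: "\<And>w. \<beta> 0 w = of_bool (w = y)"
    and beta_Suc: "\<And>k w. w \<in> I \<union> B \<Longrightarrow> \<beta> (Suc k) w = (\<Sum>x\<in>I. \<beta> k x * p x w)"
    and beta_nonneg: "\<And>k w. \<beta> k w \<ge> 0"
begin

lemma finite_parts: "finite I" "finite B"
  using sub fin finite_subset by blast+

text \<open>Mass in \<open>I\<close> moves once and, by \<open>exits\<close>, lands in
  \<open>I \<union> B\<close>. Here \<open>g\<close> is the one-step average of \<open>f\<close>
  because the test functions below change with the remaining time.\<close>

lemma one_step:
  assumes "\<And>x. x \<in> I \<Longrightarrow> g x = (\<Sum>w\<in>V. p x w * f w)"
  shows "(\<Sum>x\<in>I. \<beta> k x * g x) = (\<Sum>w\<in>I. \<beta> (Suc k) w * f w) + (\<Sum>z\<in>B. \<beta> (Suc k) z * f z)"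
proof -
  have "(\<Sum>x\<in>I. \<beta> k x * g x) = (\<Sum>x\<in>I. \<Sum>w\<in>I \<union> B. \<beta> k x * p x w * f w)"
  proof (rule sum.cong)
    fix x assume x: "x \<in> I"
    have "g x = (\<Sum>w\<in>I \<union> B. p x w * f w)"
      unfolding assms[OF x] by (rule sum.mono_neutral_right) (use fin sub exits x in auto)
    then show "\<beta> k x * g x = (\<Sum>w\<in>I \<union> B. \<beta> k x * p x w * f w)"
      by (simp add: sum_distrib_left mult.assoc)
  qed simp
  also have "\<dots> = (\<Sum>w\<in>I \<union> B. \<Sum>x\<in>I. \<beta> k x * p x w * f w)" by (rule sum.swap)
  also have "\<dots> = (\<Sum>w\<in>I \<union> B. \<beta> (Suc k) w * f w)"
    by (simp add: beta_Suc sum_distrib_right)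
  also have "\<dots> = (\<Sum>w\<in>I. \<beta> (Suc k) w * f w) + (\<Sum>z\<in>B. \<beta> (Suc k) z * f z)"
    using finite_parts disj by (simp add: sum.union_disjoint)
  finally show ?thesis .
qed

lemma initial: "(\<Sum>x\<in>I. \<beta> 0 x * f x) + (\<Sum>x\<in>B. \<beta> 0 x * f x) = f y"
proof -
  have "(\<Sum>x\<in>I. \<beta> 0 x * f x) + (\<Sum>x\<in>B. \<beta> 0 x * f x) = (\<Sum>x\<in>I \<union> B. \<beta> 0 x * f x)"
    using finite_parts disj by (simp add: sum.union_disjoint)
  also have "\<dots> = (\<Sum>x\<in>I \<union> B. if x = y then f x else 0)"
    by (rule sum.cong) (auto simp: beta_0)
  also have "\<dots> = f y" using start finite_parts by simp
  finally show ?thesis .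
qed

text \<open>Conservation of mass: only \<open>I\<close> passes mass on, so mass that reaches
  \<open>B\<close> is counted once, at the time of its arrival.\<close>

lemma total_mass: "(\<Sum>j\<le>m. \<Sum>z\<in>B. \<beta> j z) + (\<Sum>w\<in>I. \<beta> m w) = 1"
proof (induction m)
  case 0
  then show ?case using initial[of "\<lambda>_. 1"] by simp
next
  case (Suc m)
  then show ?case
    using one_step[of "\<lambda>_. 1" "\<lambda>_. 1" m] sub stochastic by (fastforce simp: subset_iff)
qed

text \<open>Decomposition at the exit time, cut off at \<open>m\<close>. Each induction step lets
  the mass still in \<open>I\<close> move once more.\<close>

lemma kpow_exit:
  assumes "m \<le> k"
  shows "kpow k y t = (\<Sum>j\<le>m. \<Sum>z\<in>B. \<beta> j z * kpow (k - j) z t) + (\<Sum>w\<in>I. \<beta> m w * kpow (k - m) w t)"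
  using assms
proof (induction m)
  case 0
  then show ?case using initial[of "\<lambda>x. kpow k x t"] by simp
next
  case (Suc m)
  then have "k - m = Suc (k - Suc m)" by simp
  then have "(\<Sum>x\<in>I. \<beta> m x * kpow (k - m) x t) =
      (\<Sum>w\<in>I. \<beta> (Suc m) w * kpow (k - Suc m) w t) + (\<Sum>z\<in>B. \<beta> (Suc m) z * kpow (k - Suc m) z t)"
    by (intro one_step) simp
  then show ?case using Suc by simp
qed

text \<open>Visits before the exit are discarded and all remaining horizons are shortened to
  \<open>n - m\<close>, so that the start enters only through the exit masses.\<close>

lemma visits_ge_exit:
  assumes "m \<le> n"
  shows "(\<Sum>j\<le>m. \<Sum>z\<in>B. \<beta> j z * visits t (n - m) z) \<le> visits t n y"
proof -
  \<comment> \<open>The induction keeps the exact horizons \<open>n - j\<close> and the surviving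
    mass. Each step loses only the \<open>of_bool\<close> term of \<open>visits_Suc\<close>, the
    visit at the current time.\<close>
  have "(\<Sum>j\<le>m. \<Sum>z\<in>B. \<beta> j z * visits t (n - j) z) + (\<Sum>w\<in>I. \<beta> m w * visits t (n - m) w)
      \<le> visits t n y" using assms
  proof (induction m)
    case 0
    then show ?case using initial[of "visits t n"] by simp
  next
    case (Suc m)
    then have n: "n - m = Suc (n - Suc m)" by simp
    have "(\<Sum>w\<in>I. \<beta> (Suc m) w * visits t (n - Suc m) w) + (\<Sum>z\<in>B. \<beta> (Suc m) z * visits t (n - Suc m) z)
        = (\<Sum>x\<in>I. \<beta> m x * (\<Sum>w\<in>V. p x w * visits t (n - Suc m) w))"
      by (rule one_step[symmetric]) simp
    also have "\<dots> \<le> (\<Sum>x\<in>I. \<beta> m x * visits t (n - m) x)"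
      unfolding n visits_Suc by (intro sum_mono mult_left_mono beta_nonneg) simp
    finally show ?case using Suc by simp
  qed
  moreover have "(\<Sum>j\<le>m. \<Sum>z\<in>B. \<beta> j z * visits t (n - m) z) \<le> (\<Sum>j\<le>m. \<Sum>z\<in>B. \<beta> j z * visits t (n - j) z)"
    by (intro sum_mono mult_left_mono visits_mono beta_nonneg) auto
  moreover have "(\<Sum>w\<in>I. \<beta> m w * visits t (n - m) w) \<ge> 0"
    by (intro sum_nonneg mult_nonneg_nonneg beta_nonneg visits_nonneg)
  ultimately show ?thesis by linarith
qed

text \<open>The window starts no earlier than any exit time \<open>j \<le> m\<close> and, shifted
  back by \<open>j\<close>, stays below \<open>n - m\<close>. The exit sum is thus the same as in
  \<open>visits_ge_exit\<close>. Survivors are covered by \<open>visits_maximal\<close>.\<close>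

lemma window_le_exit:
  assumes "2 * m \<le> n"
  shows "(\<Sum>k=m..<n - m. kpow k y t) \<le>
    (\<Sum>j\<le>m. \<Sum>z\<in>B. \<beta> j z * visits t (n - m) z) + (\<Sum>w\<in>I. \<beta> m w) * visits t (n - m) t"
proof -
  have win: "(\<Sum>k=m..<n - m. kpow (k - j) z t) \<le> visits t (n - m) z" if "j \<le> m" for j z
  proof -
    have "(\<Sum>k=m..<n - m. kpow (k - j) z t) = (\<Sum>i\<in>(\<lambda>k. k - j) ` {m..<n - m}. kpow i z t)"
      by (subst sum.reindex) (use that in \<open>auto simp: inj_on_def\<close>)
    also have "\<dots> \<le> visits t (n - m) z"
      unfolding visits_def by (intro sum_mono2) (auto simp: kpow_nonneg)
    finally show ?thesis .
  qed
  have "(\<Sum>k=m..<n - m. kpow k y t) =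
      (\<Sum>k=m..<n - m. (\<Sum>j\<le>m. \<Sum>z\<in>B. \<beta> j z * kpow (k - j) z t) + (\<Sum>w\<in>I. \<beta> m w * kpow (k - m) w t))"
    by (intro sum.cong refl kpow_exit) simp
  also have "\<dots> = (\<Sum>k=m..<n - m. \<Sum>j\<le>m. \<Sum>z\<in>B. \<beta> j z * kpow (k - j) z t) + (\<Sum>k=m..<n - m. \<Sum>w\<in>I. \<beta> m w * kpow (k - m) w t)"
    by (rule sum.distrib)
  also have "(\<Sum>k=m..<n - m. \<Sum>j\<le>m. \<Sum>z\<in>B. \<beta> j z * kpow (k - j) z t) =
      (\<Sum>j\<le>m. \<Sum>k=m..<n - m. \<Sum>z\<in>B. \<beta> j z * kpow (k - j) z t)"
    by (rule sum.swap)
  also have "\<dots> = (\<Sum>j\<le>m. \<Sum>z\<in>B. \<beta> j z * (\<Sum>k=m..<n - m. kpow (k - j) z t))"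
    unfolding sum_distrib_left by (intro sum.cong refl sum.swap)
  also have "\<dots> \<le> (\<Sum>j\<le>m. \<Sum>z\<in>B. \<beta> j z * visits t (n - m) z)"
    by (intro sum_mono mult_left_mono win beta_nonneg) simp
  also have "(\<Sum>k=m..<n - m. \<Sum>w\<in>I. \<beta> m w * kpow (k - m) w t) = (\<Sum>w\<in>I. \<beta> m w * (\<Sum>k=m..<n - m. kpow (k - m) w t))"
    unfolding sum_distrib_left by (rule sum.swap)
  also have "\<dots> \<le> (\<Sum>w\<in>I. \<beta> m w * visits t (n - m) t)"
    using win visits_maximal sub by (intro sum_mono mult_left_mono beta_nonneg) (meson le_refl order_trans sup.boundedE subsetD)
  finally show ?thesis by (simp add: sum_distrib_right)
qed

end

text \<open>Both walks meet the same function \<open>visits x (n - m)\<close> at their exit points: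
  from \<open>x\<close> the exit sum bounds the window above, from \<open>y\<close> it bounds the
  visits below. The term \<open>r\<close> leaves room for exits from \<open>y\<close> after time
  \<open>m\<close>.\<close>

lemma visits_comparison:
  assumes "killed_kernel V p I B x \<beta>" "killed_kernel V p I B y \<gamma>"
    and x: "x \<in> V" and n: "2 * m \<le> n"
    and \<delta>: "(\<Sum>w\<in>I. \<beta> m w) \<le> \<delta>" "(\<Sum>z\<in>B. r z) \<le> \<delta>" "\<delta> * (1 + 1 / c) \<le> 1 / 2"
    and c: "c > 0" and r: "\<And>z. r z \<ge> 0"
    and ratio: "\<And>z. z \<in> B \<Longrightarrow> c * (\<Sum>j\<le>m. \<beta> j z) \<le> (\<Sum>j\<le>m. \<gamma> j z) + r z"
  shows "c / 2 * (\<Sum>k=m..<n - m. finite_markov_kernel.kpow V p k x x) - (1 + c) * \<delta> * real m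
    \<le> finite_markov_kernel.visits V p x n y"
proof -
  interpret b: killed_kernel V p I B x \<beta> by fact
  interpret g: killed_kernel V p I B y \<gamma> by fact
  define A where "A = (\<Sum>k=m..<n - m. b.kpow k x x)"
  define N where "N = b.visits x (n - m)"
  have A0: "A \<ge> 0" unfolding A_def by (intro sum_nonneg b.kpow_nonneg)
  have \<delta>0: "\<delta> \<ge> 0"
    using order_trans[OF sum_nonneg \<delta>(2)] r by blast
  \<comment> \<open>Only the first \<open>m\<close> visits are estimated trivially; the others are
    \<open>A\<close> itself.\<close>
  have NA: "N x \<le> real m + A"
    unfolding N_def A_def using b.visits_split[of m "n - m" x x] b.visits_le[OF x x, of m] n by simp
  have N0: "N z \<ge> 0" for z unfolding N_def by (rule b.visits_nonneg)
  have Nmax: "N z \<le> N x" if "z \<in> B" for z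
    unfolding N_def using b.visits_maximal b.sub that by blast
  have "A \<le> (\<Sum>j\<le>m. \<Sum>z\<in>B. \<beta> j z * N z) + (\<Sum>w\<in>I. \<beta> m w) * N x"
    unfolding A_def N_def using b.window_le_exit[OF n] .
  also have "(\<Sum>j\<le>m. \<Sum>z\<in>B. \<beta> j z * N z) = (\<Sum>z\<in>B. (\<Sum>j\<le>m. \<beta> j z) * N z)"
    by (subst sum.swap) (simp add: sum_distrib_right)
  also have "(\<Sum>w\<in>I. \<beta> m w) * N x \<le> \<delta> * N x"
    using \<delta>(1) N0 by (rule mult_right_mono)
  finally have 1: "A \<le> (\<Sum>z\<in>B. (\<Sum>j\<le>m. \<beta> j z) * N z) + \<delta> * N x" by simp
  have "c * (\<Sum>z\<in>B. (\<Sum>j\<le>m. \<beta> j z) * N z) = (\<Sum>z\<in>B. c * (\<Sum>j\<le>m. \<beta> j z) * N z)"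
    by (subst sum_distrib_left) (simp add: mult.assoc)
  also have "\<dots> \<le> (\<Sum>z\<in>B. ((\<Sum>j\<le>m. \<gamma> j z) + r z) * N z)"
    by (intro sum_mono mult_right_mono ratio N0)
  also have "\<dots> = (\<Sum>z\<in>B. (\<Sum>j\<le>m. \<gamma> j z) * N z) + (\<Sum>z\<in>B. r z * N z)"
    by (simp add: distrib_right sum.distrib)
  also have "(\<Sum>z\<in>B. (\<Sum>j\<le>m. \<gamma> j z) * N z) = (\<Sum>j\<le>m. \<Sum>z\<in>B. \<gamma> j z * N z)"
    by (subst sum.swap) (simp add: sum_distrib_right)
  also have "\<dots> \<le> b.visits x n y"
    unfolding N_def using g.visits_ge_exit[of m n x] n by simp
  also have "(\<Sum>z\<in>B. r z * N z) \<le> (\<Sum>z\<in>B. r z) * N x"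
    unfolding sum_distrib_right by (intro sum_mono mult_left_mono Nmax r)
  also have "\<dots> \<le> \<delta> * N x" using \<delta>(2) N0 by (rule mult_right_mono)
  finally have 2: "c * (\<Sum>z\<in>B. (\<Sum>j\<le>m. \<beta> j z) * N z) \<le> b.visits x n y + \<delta> * N x" by simp
  have "c * A \<le> c * ((\<Sum>z\<in>B. (\<Sum>j\<le>m. \<beta> j z) * N z) + \<delta> * N x)"
    using 1 c by simp
  also have "\<dots> \<le> b.visits x n y + (1 + c) * \<delta> * N x"
    using 2 by (simp add: algebra_simps)
  also have "(1 + c) * \<delta> * N x \<le> (1 + c) * \<delta> * (real m + A)"
    using NA c \<delta>0 by (intro mult_left_mono) auto
  finally have "c * A \<le> b.visits x n y + (1 + c) * \<delta> * real m + (1 + c) * \<delta> * A"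
    by (simp add: algebra_simps)
  \<comment> \<open>Multiplied by \<open>c\<close>, the last bound on \<open>\<delta>\<close> reads
    \<open>(1 + c) * \<delta> \<le> c / 2\<close>, so this error uses up at most half of
    \<open>c * A\<close>.\<close>
  moreover have "(1 + c) * \<delta> * A \<le> c / 2 * A"
    using \<delta>(3) c A0 by (intro mult_right_mono) (simp_all add: field_simps)
  ultimately show ?thesis unfolding A_def by linarith
qed

text \<open>Detailed balance passes to powers: a first step peeled off on one side becomes the last
  step on the other.\<close>

lemma (in finite_markov_kernel) kpow_reversible:
  assumes rev: "\<And>x y. x \<in> V \<Longrightarrow> y \<in> V \<Longrightarrow> w x * p x y = w y * p y x"
  shows "x \<in> V \<Longrightarrow> y \<in> V \<Longrightarrow> w x * kpow k x y = w y * kpow k y x"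
proof (induction k arbitrary: x y)
  case 0
  then show ?case by auto
next
  case (Suc k)
  have "w x * kpow (Suc k) x y = (\<Sum>z\<in>V. w x * p x z * kpow k z y)"
    by (simp add: sum_distrib_left mult.assoc)
  also have "\<dots> = (\<Sum>z\<in>V. p z x * (w z * kpow k z y))"
    by (rule sum.cong) (use rev Suc.prems in \<open>auto simp: mult_ac\<close>)
  also have "\<dots> = (\<Sum>z\<in>V. w y * (kpow k y z * p z x))"
    by (rule sum.cong) (use Suc in \<open>auto simp: mult_ac\<close>)
  also have "\<dots> = w y * kpow (Suc k) y x"
    using Suc.prems by (subst kpow_Suc_right) (auto simp: sum_distrib_left)
  finally show ?case .
qed

text \<open>With \<open>W\<close> the total weight, Cauchy--Schwarz and reversibility give
  \<open>w x / W\<close> at even times. An odd time needs one more holding step at \<open>x\<close>,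
  which costs a factor \<open>1 / w x\<close>.\<close>

lemma (in finite_markov_kernel) kpow_return_ge:
  assumes rev: "\<And>x y. x \<in> V \<Longrightarrow> y \<in> V \<Longrightarrow> w x * p x y = w y * p y x"
    and pos: "\<And>x. x \<in> V \<Longrightarrow> w x \<ge> 1" and x: "x \<in> V" and loop: "p x x \<ge> 1 / w x"
  shows "kpow k x x \<ge> 1 / (\<Sum>y\<in>V. w y)"
proof -
  define W where "W = (\<Sum>y\<in>V. w y)"
  have W: "W > 0"
    unfolding W_def using x fin pos by (intro sum_pos) (auto intro: less_le_trans[OF zero_less_one])
  have even: "kpow (j + j) x x \<ge> w x / W" for j
  proof -
    \<comment> \<open>With the weights \<open>sqrt (w y)\<close>, reversibility turns the summands
      of the first factor into \<open>kpow j x y * kpow j y x / w x\<close>, which add up to a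
      return probability at time \<open>j + j\<close>.\<close>
    have "1 = (\<Sum>y\<in>V. (kpow j x y / sqrt (w y)) * sqrt (w y))\<^sup>2"
      using kpow_sum[OF x, of j] pos by (simp cong: sum.cong) (smt (verit) sum.cong nonzero_eq_divide_eq real_sqrt_eq_0_iff one_power2)
    also have "\<dots> \<le> (\<Sum>y\<in>V. (kpow j x y / sqrt (w y))\<^sup>2) * (\<Sum>y\<in>V. (sqrt (w y))\<^sup>2)"
      by (rule Cauchy_Schwarz_ineq_sum)
    also have "(\<Sum>y\<in>V. (sqrt (w y))\<^sup>2) = W"
      unfolding W_def using pos by (intro sum.cong) (auto intro: order_trans[OF zero_le_one])
    also have "(\<Sum>y\<in>V. (kpow j x y / sqrt (w y))\<^sup>2) = (\<Sum>y\<in>V. kpow j x y * kpow j y x / w x)"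
    proof (rule sum.cong)
      fix y assume y: "y \<in> V"
      have "w x * kpow j x y = w y * kpow j y x" by (rule kpow_reversible[OF rev x y])
      moreover have "w x > 0" "w y > 0" using pos[OF x] pos[OF y] by auto
      ultimately show "(kpow j x y / sqrt (w y))\<^sup>2 = kpow j x y * kpow j y x / w x"
        by (simp add: power_divide power2_eq_square field_simps)
    qed simp
    also have "\<dots> = kpow (j + j) x x / w x"
      by (simp add: kpow_add[OF x] sum_divide_distrib)
    finally show ?thesis using W pos[OF x] by (simp add: field_simps)
  qed
  have wx: "w x \<ge> 1" using pos x by blast
  have "kpow k x x \<ge> 1 / W"
  proof (cases "even k")
    case True
    then obtain j where "k = j + j" by (metis evenE mult_2)
    with even[of j] wx W show ?thesis
      by (smt (verit) divide_right_mono)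
  next
    case False
    then obtain j where k: "k = Suc (j + j)" by (metis oddE mult_2 Suc_eq_plus1)
    have "1 / W = (w x / W) * (1 / w x)" using wx by simp
    also have "\<dots> \<le> kpow (j + j) x x * p x x"
      using even[of j] loop wx W by (intro mult_mono) (auto intro: kpow_nonneg)
    also have "\<dots> \<le> (\<Sum>z\<in>V. kpow (j + j) x z * p z x)"
      using fin x by (intro member_le_sum) (auto intro: mult_nonneg_nonneg kpow_nonneg nonneg)
    also have "\<dots> = kpow k x x" unfolding k by (rule kpow_Suc_right[OF x x, symmetric])
    finally show ?thesis .
  qed
  then show ?thesis by (simp add: W_def)
qed

subsection \<open>Paths of Markov chains\<close>

text \<open>The infimum of a nonempty set of times is attained because \<open>enat\<close> is
  well-ordered.\<close>

lemma hitting_time_eq_enat_iff: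
  "hitting_time B \<xi> = enat t \<longleftrightarrow> \<xi> t \<in> B \<and> (\<forall>s<t. \<xi> s \<notin> B)"
proof
  assume h: "hitting_time B \<xi> = enat t"
  define S where "S = {s. \<xi> s \<in> B}"
  have "enat ` S \<noteq> {}"
  proof
    assume "enat ` S = {}"
    then have "hitting_time B \<xi> = \<infinity>"
      unfolding hitting_time_def S_def by (metis Inf_enat_def)
    with h show False by simp
  qed
  then obtain u where "u \<in> enat ` S" by blast
  then have "Inf (enat ` S) \<in> enat ` S" by (rule wellorder_InfI)
  then have "enat t \<in> enat ` S" using h unfolding hitting_time_def S_def by metis
  then have "\<xi> t \<in> B" unfolding S_def by blast
  moreover have "\<xi> s \<notin> B" if "s < t" for s
  proof
    assume "\<xi> s \<in> B"
    then have "Inf (enat ` S) \<le> enat s" unfolding S_def by (intro Inf_lower) auto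
    with h that show False unfolding hitting_time_def S_def by simp
  qed
  ultimately show "\<xi> t \<in> B \<and> (\<forall>s<t. \<xi> s \<notin> B)" by blast
next
  assume t: "\<xi> t \<in> B \<and> (\<forall>s<t. \<xi> s \<notin> B)"
  show "hitting_time B \<xi> = enat t"
    unfolding hitting_time_def
  proof (rule antisym)
    show "Inf (enat ` {t. \<xi> t \<in> B}) \<le> enat t" by (rule Inf_lower) (use t in auto)
    show "enat t \<le> Inf (enat ` {t. \<xi> t \<in> B})"
      by (rule Inf_greatest) (use t in \<open>auto simp: not_less[symmetric]\<close>)
  qed
qed

lemma hitting_time_gt_iff:
  "ereal_of_enat (hitting_time B \<xi>) > ereal \<theta> \<longleftrightarrow> (\<forall>k. real k \<le> \<theta> \<longrightarrow> \<xi> k \<notin> B)"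
proof (cases "\<exists>k. \<xi> k \<in> B")
  case True
  define k where "k = (LEAST k. \<xi> k \<in> B)"
  have k: "\<xi> k \<in> B" "\<And>s. s < k \<Longrightarrow> \<xi> s \<notin> B"
    unfolding k_def using True LeastI_ex not_less_Least by (metis, metis)
  then have "hitting_time B \<xi> = enat k" by (simp add: hitting_time_eq_enat_iff)
  then show ?thesis
    using k by (auto simp: not_le)
next
  case False
  then show ?thesis by (auto simp: hitting_time_def Inf_enat_def)
qed

text \<open>The end point is unconstrained, so that survival (\<open>w\<close> inside) and exit
  (\<open>w\<close> outside) are both covered. The sets depend on time to include the growing vertex
  sets besides a fixed interior.\<close>

definition path_prob ::
  "'w measure \<Rightarrow> (nat \<Rightarrow> 'w \<Rightarrow> 'v) \<Rightarrow> (nat \<Rightarrow> 'v set) \<Rightarrow> nat \<Rightarrow> 'v \<Rightarrow> real" where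
  "path_prob M X A k w = measure M {\<omega> \<in> space M. (\<forall>s<k. X s \<omega> \<in> A s) \<and> X k \<omega> = w}"

lemma path_prob_nonneg: "path_prob M X A k w \<ge> 0"
  by (simp add: path_prob_def)

lemma markov_chain_from_measurable:
  assumes "markov_chain_from M X S p x"
  shows "Measurable.pred M (\<lambda>\<omega>. X t \<omega> \<in> U)"
proof -
  have "X t \<in> measurable M (count_space S)"
    using assms by (simp add: markov_chain_from_def)
  then have "X t -` (U \<inter> S) \<inter> space M \<in> sets M" "\<And>\<omega>. \<omega> \<in> space M \<Longrightarrow> X t \<omega> \<in> S"
    using measurable_sets[of "X t" M "count_space S" "U \<inter> S"] measurable_space[of "X t" M "count_space S"]
    by simp_all
  moreover from this(2) have "{\<omega> \<in> space M. X t \<omega> \<in> U} = X t -` (U \<inter> S) \<inter> space M" by auto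
  ultimately show ?thesis by (simp add: pred_def)
qed

lemma path_prob_0:
  assumes "markov_chain_from M X S p x"
  shows "path_prob M X A 0 w = of_bool (w = x)"
proof -
  interpret prob_space M using assms by (simp add: markov_chain_from_def)
  have [measurable]: "Measurable.pred M (\<lambda>\<omega>. X 0 \<omega> = u)" for u
    using markov_chain_from_measurable[OF assms, of 0 "{u}"] by simp
  have ae: "AE \<omega> in M. X 0 \<omega> = x" using assms by (simp add: markov_chain_from_def)
  show ?thesis
  proof (cases "w = x")
    case True
    then have "prob {\<omega> \<in> space M. X 0 \<omega> = w} = 1"
      using ae by (subst prob_Collect_eq_1) auto
    then show ?thesis using True by (simp add: path_prob_def)
  next
    case False
    then have "prob {\<omega> \<in> space M. X 0 \<omega> = w} = 0"
      using ae by (subst prob_Collect_eq_0) auto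
    then show ?thesis using False by (simp add: path_prob_def)
  qed
qed

text \<open>The Markov property is given for single histories. Finite sets \<open>A s\<close> leave
  finitely many admissible histories up to time \<open>k\<close>, over which it is summed, grouped
  by the state at time \<open>k\<close>.\<close>

lemma path_prob_Suc:
  assumes mc: "markov_chain_from M X S p x" and A: "\<And>s. finite (A s)"
  shows "path_prob M X A (Suc k) w = (\<Sum>x\<in>A k. path_prob M X A k x * p k x w)"
proof -
  interpret prob_space M using mc by (simp add: markov_chain_from_def)
  have [measurable]: "Measurable.pred M (\<lambda>\<omega>. X t \<omega> = u)" for t u
    using markov_chain_from_measurable[OF mc, of t "{u}"] by simp
  \<comment> \<open>Extensionality makes distinct histories differ at some time
    \<open>s \<le> k\<close>, so their events are disjoint.\<close>
  define H where "H = PiE {..k} (\<lambda>s. A s)"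
  have H: "finite H" unfolding H_def by (intro finite_PiE) (auto simp: A)
  define ev where "ev \<xi> = {\<omega> \<in> space M. \<forall>s\<le>k. X s \<omega> = \<xi> s}" for \<xi>
  have ev: "ev \<xi> \<in> sets M" for \<xi> unfolding ev_def by measurable
  have ev_disj: "ev \<xi> \<inter> ev \<zeta> = {}" if "\<xi> \<in> H" "\<zeta> \<in> H" "\<xi> \<noteq> \<zeta>" for \<xi> \<zeta>
  proof (rule ccontr)
    assume "ev \<xi> \<inter> ev \<zeta> \<noteq> {}"
    then have "\<forall>s\<le>k. \<xi> s = \<zeta> s" unfolding ev_def by auto
    with that show False unfolding H_def by (auto intro: PiE_ext)
  qed
  have hist: "\<exists>\<xi>\<in>H. \<omega> \<in> ev \<xi>" if "\<omega> \<in> space M" "\<forall>s\<le>k. X s \<omega> \<in> A s" for \<omega>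
    using that by (intro bexI[of _ "restrict (\<lambda>s. X s \<omega>) {..k}"]) (auto simp: ev_def H_def)
  have evk: "X s \<omega> \<in> A s" if "\<omega> \<in> ev \<xi>" "\<xi> \<in> H" "s \<le> k" for \<omega> \<xi> s
    using that unfolding ev_def H_def by (auto simp: PiE_iff)
  have step: "measure M {\<omega> \<in> space M. (\<forall>s\<le>k. X s \<omega> = \<xi> s) \<and> X (Suc k) \<omega> = w}
      = measure M (ev \<xi>) * p k (\<xi> k) w" for \<xi>
    using mc unfolding markov_chain_from_def ev_def by blast
  have pk: "path_prob M X A k x = (\<Sum>\<xi> | \<xi> \<in> H \<and> \<xi> k = x. measure M (ev \<xi>))" if "x \<in> A k" for x
  proof -
    have "{\<omega> \<in> space M. (\<forall>s<k. X s \<omega> \<in> A s) \<and> X k \<omega> = x} = (\<Union>\<xi>\<in>{\<xi> \<in> H. \<xi> k = x}. ev \<xi>)"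
      (is "?L = ?R")
    proof
      show "?L \<subseteq> ?R"
      proof
        fix \<omega> assume \<omega>: "\<omega> \<in> ?L"
        with that have "\<omega> \<in> space M" "\<forall>s\<le>k. X s \<omega> \<in> A s" by (auto simp: le_less)
        from hist[OF this] obtain \<xi> where "\<xi> \<in> H" "\<omega> \<in> ev \<xi>" by blast
        moreover from this \<omega> have "\<xi> k = x" by (auto simp: ev_def)
        ultimately show "\<omega> \<in> ?R" by blast
      qed
      show "?R \<subseteq> ?L" using evk by (auto simp: ev_def)
    qed
    moreover have "measure M (\<Union>\<xi>\<in>{\<xi> \<in> H. \<xi> k = x}. ev \<xi>) = (\<Sum>\<xi> | \<xi> \<in> H \<and> \<xi> k = x. measure M (ev \<xi>))"
      by (rule finite_measure_finite_Union) (use H ev ev_disj in \<open>auto simp: disjoint_family_on_def\<close>)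
    ultimately show ?thesis by (simp add: path_prob_def)
  qed
  define ev' where "ev' \<xi> = {\<omega> \<in> ev \<xi>. X (Suc k) \<omega> = w}" for \<xi>
  have ev': "ev' \<xi> \<in> sets M" for \<xi> unfolding ev'_def ev_def by measurable
  have "{\<omega> \<in> space M. (\<forall>s<Suc k. X s \<omega> \<in> A s) \<and> X (Suc k) \<omega> = w} = (\<Union>\<xi>\<in>H. ev' \<xi>)"
  proof (intro equalityI subsetI)
    fix \<omega> assume \<omega>: "\<omega> \<in> {\<omega> \<in> space M. (\<forall>s<Suc k. X s \<omega> \<in> A s) \<and> X (Suc k) \<omega> = w}"
    then obtain \<xi> where "\<xi> \<in> H" "\<omega> \<in> ev \<xi>" using hist[of \<omega>] by (auto simp: less_Suc_eq_le)
    with \<omega> show "\<omega> \<in> (\<Union>\<xi>\<in>H. ev' \<xi>)" by (auto simp: ev'_def)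
  next
    fix \<omega> assume "\<omega> \<in> (\<Union>\<xi>\<in>H. ev' \<xi>)"
    then obtain \<xi> where \<xi>: "\<xi> \<in> H" "\<omega> \<in> ev \<xi>" "X (Suc k) \<omega> = w" by (auto simp: ev'_def)
    then have "\<forall>s<Suc k. X s \<omega> \<in> A s" using evk by (simp add: less_Suc_eq_le)
    then show "\<omega> \<in> {\<omega> \<in> space M. (\<forall>s<Suc k. X s \<omega> \<in> A s) \<and> X (Suc k) \<omega> = w}"
      using \<xi> by (simp add: ev_def)
  qed
  moreover have "measure M (\<Union>\<xi>\<in>H. ev' \<xi>) = (\<Sum>\<xi>\<in>H. measure M (ev' \<xi>))"
    by (rule finite_measure_finite_Union) (use H ev' ev_disj in \<open>auto simp: disjoint_family_on_def ev'_def\<close>)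
  ultimately have "path_prob M X A (Suc k) w = (\<Sum>\<xi>\<in>H. measure M (ev' \<xi>))"
    by (simp add: path_prob_def)
  also have "\<dots> = (\<Sum>\<xi>\<in>H. measure M (ev \<xi>) * p k (\<xi> k) w)"
    unfolding step[symmetric] by (simp add: ev'_def ev_def conj_assoc)
  also have "\<dots> = (\<Sum>x\<in>A k. \<Sum>\<xi> | \<xi> \<in> H \<and> \<xi> k = x. measure M (ev \<xi>) * p k (\<xi> k) w)"
    by (rule sum.group[symmetric]) (use H A in \<open>auto simp: H_def PiE_iff\<close>)
  also have "\<dots> = (\<Sum>x\<in>A k. path_prob M X A k x * p k x w)"
    by (intro sum.cong) (auto simp: pk sum_distrib_right)
  finally show ?thesis .
qed

lemma path_prob_sum:
  assumes mc: "markov_chain_from M X S p x" and C: "finite C"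
  shows "measure M {\<omega> \<in> space M. (\<forall>s<k. X s \<omega> \<in> A s) \<and> X k \<omega> \<in> C} = (\<Sum>w\<in>C. path_prob M X A k w)"
proof -
  interpret prob_space M using mc by (simp add: markov_chain_from_def)
  note [measurable] = markov_chain_from_measurable[OF mc]
  have [measurable]: "Measurable.pred M (\<lambda>\<omega>. X t \<omega> = u)" for t u
    using markov_chain_from_measurable[OF mc, of t "{u}"] by simp
  have "{\<omega> \<in> space M. (\<forall>s<k. X s \<omega> \<in> A s) \<and> X k \<omega> \<in> C} =
      (\<Union>w\<in>C. {\<omega> \<in> space M. (\<forall>s<k. X s \<omega> \<in> A s) \<and> X k \<omega> = w})" by auto
  moreover have "measure M \<dots> = (\<Sum>w\<in>C. path_prob M X A k w)"
    unfolding path_prob_def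
    by (rule finite_measure_finite_Union) (use C in \<open>auto simp: disjoint_family_on_def\<close>)
  ultimately show ?thesis by simp
qed

text \<open>Nothing relates \<open>p\<close> to the sets, so a path might leave \<open>I\<close>
  without entering \<open>B\<close>. That this has probability 0 up to time \<open>m\<close> enters
  \<open>exit_le_partial\<close> through its hypothesis \<open>mass\<close>.\<close>

locale killed_markov_chain =
  fixes M :: "'w measure" and X :: "nat \<Rightarrow> 'w \<Rightarrow> 'v" and S p y
    and I B :: "'v set"
  assumes mc: "markov_chain_from M X S p y"
    and finI: "finite I" and finB: "finite B" and disj: "I \<inter> B = {}"
begin

sublocale prob_space M using mc by (simp add: markov_chain_from_def)

lemma measurable_hit [measurable]: "Measurable.pred M (\<lambda>\<omega>. X t \<omega> \<in> U)"
  by (rule markov_chain_from_measurable[OF mc])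

lemma measurable_at [measurable]: "Measurable.pred M (\<lambda>\<omega>. X t \<omega> = u)"
  using markov_chain_from_measurable[OF mc, of t "{u}"] by simp

abbreviation "exit_at z \<equiv> {\<omega> \<in> space M. \<exists>t. hitting_time B (\<lambda>t. X t \<omega>) = enat t \<and> X t \<omega> = z}"

lemma exit_at_sets [measurable]: "exit_at z \<in> sets M"
  unfolding hitting_time_eq_enat_iff by measurable

lemma survival_le:
  assumes "\<theta> \<le> real m"
  shows "(\<Sum>w\<in>I. path_prob M X (\<lambda>_. I) m w)
    \<le> measure M {\<omega> \<in> space M. ereal_of_enat (hitting_time B (\<lambda>t. X t \<omega>)) > ereal \<theta>}"
proof -
  have sub: "X k \<omega> \<notin> B" if "\<forall>s<m. X s \<omega> \<in> I" "X m \<omega> \<in> I" "real k \<le> \<theta>" for \<omega> k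
  proof -
    have "k \<le> m" using that(3) assms by simp
    then show ?thesis using that(1,2) disj by (auto simp: le_less)
  qed
  show ?thesis
    unfolding path_prob_sum[OF mc finI, symmetric] hitting_time_gt_iff
    by (rule finite_measure_mono) (use sub in auto)
qed

text \<open>The events behind the summands are disjoint, since \<open>z\<close> lies outside
  \<open>I\<close>, and each makes \<open>z\<close> the first point visited in
  \<open>B\<close>.\<close>

lemma partial_exit_le:
  assumes "z \<in> B"
  shows "(\<Sum>j\<le>m. path_prob M X (\<lambda>_. I) j z) \<le> measure M (exit_at z)"
proof -
  define ev where "ev j = {\<omega> \<in> space M. (\<forall>s<j. X s \<omega> \<in> I) \<and> X j \<omega> = z}" for j
  have ev: "ev j \<in> sets M" for j unfolding ev_def by measurable
  have "X s \<omega> \<in> I" if "\<omega> \<in> ev k" "s < k" for \<omega> k s using that by (auto simp: ev_def)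
  moreover have "X j \<omega> \<notin> I" if "\<omega> \<in> ev j" for \<omega> j using that assms disj by (auto simp: ev_def)
  ultimately have "ev j \<inter> ev k = {}" if "j \<noteq> k" for j k
    using that by (metis disjoint_iff linorder_neqE_nat)
  then have "(\<Sum>j\<le>m. path_prob M X (\<lambda>_. I) j z) = measure M (\<Union>j\<le>m. ev j)"
    unfolding path_prob_def using ev
    by (subst finite_measure_finite_Union) (auto simp: disjoint_family_on_def ev_def)
  also have "\<dots> \<le> measure M (exit_at z)"
  proof (rule finite_measure_mono)
    show "(\<Union>j\<le>m. ev j) \<subseteq> exit_at z"
      unfolding hitting_time_eq_enat_iff ev_def using assms disj by blast
  qed simp
  finally show ?thesis .
qed

text \<open>By \<open>mass\<close>, almost every path either steps from \<open>I\<close> into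
  \<open>B\<close> by time \<open>m\<close>, or starts in \<open>B\<close>, or stays in
  \<open>I\<close> through time \<open>m\<close>. An exit at \<open>z\<close> is therefore early or
  belongs to a survivor.\<close>

lemma exit_le_partial:
  assumes mass: "(\<Sum>j\<le>m. \<Sum>z\<in>B. path_prob M X (\<lambda>_. I) j z) + (\<Sum>w\<in>I. path_prob M X (\<lambda>_. I) m w) = 1"
  shows "measure M (exit_at z) \<le> (\<Sum>j\<le>m. path_prob M X (\<lambda>_. I) j z) +
    measure M {\<omega> \<in> exit_at z. (\<forall>s<m. X s \<omega> \<in> I) \<and> X m \<omega> \<in> I}"
proof -
  define D where "D j = {\<omega> \<in> space M. (\<forall>s<j. X s \<omega> \<in> I) \<and> X j \<omega> \<in> B}" for j
  define L where "L = {\<omega> \<in> space M. (\<forall>s<m. X s \<omega> \<in> I) \<and> X m \<omega> \<in> I}"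
  have D[measurable]: "D j \<in> sets M" for j unfolding D_def by measurable
  have L[measurable]: "L \<in> sets M" unfolding L_def by measurable
  have DI: "X s \<omega> \<in> I" if "\<omega> \<in> D k" "s < k" for \<omega> k s using that by (auto simp: D_def)
  have DB: "X j \<omega> \<notin> I" if "\<omega> \<in> D j" for \<omega> j using that disj by (auto simp: D_def)
  have Ddisj: "D j \<inter> D k = {}" if "j \<noteq> k" for j k
    using that DI DB by (metis disjoint_iff linorder_neqE_nat)
  have LI: "X s \<omega> \<in> I" if "\<omega> \<in> L" "s \<le> m" for \<omega> s using that by (auto simp: L_def le_less)
  have LD: "(\<Union>j\<le>m. D j) \<inter> L = {}"
    using LI DB by fastforce
  have "measure M ((\<Union>j\<le>m. D j) \<union> L) = measure M (\<Union>j\<le>m. D j) + measure M L"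
    using LD by (intro finite_measure_Union) auto
  also have "measure M (\<Union>j\<le>m. D j) = (\<Sum>j\<le>m. measure M (D j))"
    using Ddisj by (intro finite_measure_finite_Union) (auto simp: disjoint_family_on_def)
  also have "(\<Sum>j\<le>m. measure M (D j)) + measure M L = 1"
    using mass unfolding D_def L_def path_prob_sum[OF mc finB] path_prob_sum[OF mc finI] .
  finally have full: "AE \<omega> in M. \<omega> \<in> (\<Union>j\<le>m. D j) \<union> L"
    by (intro AE_prob_1)
  have dec: "\<omega> \<in> (\<Union>j\<le>m. {\<omega> \<in> space M. (\<forall>s<j. X s \<omega> \<in> I) \<and> X j \<omega> = z}) \<union> {\<omega> \<in> exit_at z. (\<forall>s<m. X s \<omega> \<in> I) \<and> X m \<omega> \<in> I}"
    if \<omega>: "\<omega> \<in> (\<Union>j\<le>m. D j) \<union> L" "\<omega> \<in> exit_at z" for \<omega>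
  proof (cases "\<omega> \<in> L")
    case True
    then show ?thesis using \<omega>(2) by (auto simp: L_def)
  next
    case False
    then obtain j where j: "j \<le> m" "\<omega> \<in> D j" using \<omega>(1) by auto
    from \<omega>(2) obtain t where t: "X t \<omega> \<in> B" "\<forall>s<t. X s \<omega> \<notin> B" "X t \<omega> = z"
      unfolding hitting_time_eq_enat_iff by auto
    have "t = j"
      using j(2) t(1,2) disj unfolding D_def by (cases t j rule: linorder_cases) auto
    then show ?thesis using j t(3) by (auto simp: D_def)
  qed
  have "measure M (exit_at z) \<le> measure M ((\<Union>j\<le>m. {\<omega> \<in> space M. (\<forall>s<j. X s \<omega> \<in> I) \<and> X j \<omega> = z})
      \<union> {\<omega> \<in> exit_at z. (\<forall>s<m. X s \<omega> \<in> I) \<and> X m \<omega> \<in> I})"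
  proof (rule finite_measure_mono_AE)
    show "AE \<omega> in M. \<omega> \<in> exit_at z \<longrightarrow> \<omega> \<in> (\<Union>j\<le>m. {\<omega> \<in> space M. (\<forall>s<j. X s \<omega> \<in> I) \<and> X j \<omega> = z})
      \<union> {\<omega> \<in> exit_at z. (\<forall>s<m. X s \<omega> \<in> I) \<and> X m \<omega> \<in> I}"
      using full by (rule eventually_mono) (use dec in blast)
  qed measurable
  also have "\<dots> \<le> measure M (\<Union>j\<le>m. {\<omega> \<in> space M. (\<forall>s<j. X s \<omega> \<in> I) \<and> X j \<omega> = z})
      + measure M {\<omega> \<in> exit_at z. (\<forall>s<m. X s \<omega> \<in> I) \<and> X m \<omega> \<in> I}"
    by (rule measure_Un_le) measurable
  also have "measure M (\<Union>j\<le>m. {\<omega> \<in> space M. (\<forall>s<j. X s \<omega> \<in> I) \<and> X j \<omega> = z})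
      \<le> (\<Sum>j\<le>m. path_prob M X (\<lambda>_. I) j z)"
    unfolding path_prob_def by (intro measure_UNION_le) auto
  finally show ?thesis by simp
qed

text \<open>A path has one exit point, so the events for different \<open>z\<close> are disjoint,
  and all lie in the survival event.\<close>

lemma late_exit_le:
  "(\<Sum>z\<in>B. measure M {\<omega> \<in> exit_at z. (\<forall>s<m. X s \<omega> \<in> I) \<and> X m \<omega> \<in> I})
    \<le> (\<Sum>w\<in>I. path_prob M X (\<lambda>_. I) m w)"
proof -
  have "disjoint_family_on (\<lambda>z. {\<omega> \<in> exit_at z. (\<forall>s<m. X s \<omega> \<in> I) \<and> X m \<omega> \<in> I}) B"
    by (auto simp: disjoint_family_on_def)
  then have "(\<Sum>z\<in>B. measure M {\<omega> \<in> exit_at z. (\<forall>s<m. X s \<omega> \<in> I) \<and> X m \<omega> \<in> I})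
    = measure M (\<Union>z\<in>B. {\<omega> \<in> exit_at z. (\<forall>s<m. X s \<omega> \<in> I) \<and> X m \<omega> \<in> I})"
    using finB by (subst finite_measure_finite_Union) auto
  also have "\<dots> \<le> (\<Sum>w\<in>I. path_prob M X (\<lambda>_. I) m w)"
    unfolding path_prob_sum[OF mc finI, symmetric] by (intro finite_measure_mono) auto
  finally show ?thesis .
qed

end

subsection \<open>Random walks on multigraphs\<close>

lemma edge_mult_commute: "edge_mult G x y = edge_mult G y x"
  unfolding edge_mult_def by (metis Upair_inject)

lemma wf_graph_ends:
  "wf_graph G \<Longrightarrow> e \<in> edges G \<Longrightarrow> ends G e = Upair x y \<Longrightarrow> x \<in> verts G \<and> y \<in> verts G"
  unfolding wf_graph_def by fastforce

lemma edge_mult_outside: "wf_graph G \<Longrightarrow> y \<notin> verts G \<Longrightarrow> edge_mult G x y = 0"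
  unfolding edge_mult_def using wf_graph_ends by (metis (mono_tags, lifting) card.empty empty_Collect_eq)

lemma deg_eq_sum:
  assumes "finite (verts G)"
  shows "deg G x = (\<Sum>y\<in>verts G. edge_mult G x y)"
  unfolding deg_def using assms by (intro sum.mono_neutral_left) auto

lemma edge_mult_le_deg: "finite (verts G) \<Longrightarrow> y \<in> verts G \<Longrightarrow> edge_mult G x y \<le> deg G x"
  unfolding deg_eq_sum by (rule member_le_sum) auto

lemma wf_graph_snapshot: "wf_graph (snapshot G F)"
  by (simp add: wf_graph_def snapshot_def Let_def)

lemma subgraph_snapshot: "F \<subseteq> edges G \<Longrightarrow> subgraph (snapshot G F) G"
  using wf_graph_snapshot[of G F] by (auto simp: subgraph_def snapshot_def Let_def)

lemma verts_snapshot_mono: "F \<subseteq> F' \<Longrightarrow> verts (snapshot G F) \<subseteq> verts (snapshot G F')"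
  by (auto simp: snapshot_def Let_def)

lemma subgraph_trans: "subgraph A B \<Longrightarrow> subgraph B C \<Longrightarrow> subgraph A C"
  by (auto simp: subgraph_def)

lemma adjacent_interior:
  assumes "wf_graph G" "x \<in> verts K - inner_boundary G K" "adjacent G x y"
  shows "y \<in> verts K"
  using assms wf_graph_ends unfolding adjacent_def inner_boundary_def by fastforce

text \<open>All edges of \<open>G\<close> at an interior vertex of \<open>K\<close> end in
  \<open>K\<close>, hence belong to the induced \<open>K\<close> and to every \<open>H\<close>
  between \<open>K\<close> and \<open>G\<close>. With \<open>deg_interior\<close>, the walks on
  \<open>H\<close> and \<open>G\<close> have equal steps until they meet the boundary of
  \<open>K\<close>.\<close>

lemma edge_mult_interior:
  assumes "wf_graph G" "subgraph K H" "subgraph H G" "edges_induced K G"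
    and x: "x \<in> verts K - inner_boundary G K"
  shows "edge_mult H x y = edge_mult G x y"
proof -
  have "e \<in> edges H" if "e \<in> edges G" "ends G e = Upair x y" for e
  proof -
    have "y \<in> verts K"
      by (rule adjacent_interior[OF assms(1) x]) (use that in \<open>auto simp: adjacent_def\<close>)
    then have "e \<in> edges K" using assms(4) x that by (auto simp: edges_induced_def)
    then show ?thesis using assms(2) by (auto simp: subgraph_def)
  qed
  then have "{e \<in> edges H. ends H e = Upair x y} = {e \<in> edges G. ends G e = Upair x y}"
    using assms(3) by (auto simp: subgraph_def)
  then show ?thesis by (simp add: edge_mult_def)
qed

lemma edge_mult_nonzero_interior:
  assumes "wf_graph G" "x \<in> verts K - inner_boundary G K" "edge_mult G x y \<noteq> 0"
  shows "y \<in> verts K"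
proof -
  have "{e \<in> edges G. ends G e = Upair x y} \<noteq> {}"
    using assms(3) unfolding edge_mult_def by (metis card.empty)
  then show ?thesis
    by (intro adjacent_interior[OF assms(1,2)]) (auto simp: adjacent_def)
qed

lemma deg_interior:
  assumes "wf_graph G" "subgraph K H" "subgraph H G" "edges_induced K G"
    and x: "x \<in> verts K - inner_boundary G K"
  shows "deg H x = deg G x"
proof -
  have sub: "verts K \<subseteq> verts H" "verts H \<subseteq> verts G" using assms by (auto simp: subgraph_def)
  have "{y \<in> verts H. edge_mult G x y \<noteq> 0} = {y \<in> verts G. edge_mult G x y \<noteq> 0}"
    using edge_mult_nonzero_interior[OF assms(1) x] sub by blast
  then show ?thesis
    unfolding deg_def edge_mult_interior[OF assms] by simp
qed

locale lazy_finite_graph =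
  fixes H :: "('v, 'e) multigraph"
  assumes wf: "wf_graph H" and finite_verts: "finite (verts H)"
    and loop: "\<And>x. x \<in> verts H \<Longrightarrow> edge_mult H x x \<ge> 1"
begin

lemma deg_ge_1: "x \<in> verts H \<Longrightarrow> real (deg H x) \<ge> 1"
  using edge_mult_le_deg[OF finite_verts, of x x] loop[of x] by simp

sublocale srw: finite_markov_kernel "verts H" "srw_step H"
proof
  fix x assume "x \<in> verts H"
  then show "(\<Sum>y\<in>verts H. srw_step H x y) = 1"
    using deg_ge_1[of x] deg_eq_sum[OF finite_verts, of x]
    by (simp add: srw_step_def sum_divide_distrib[symmetric] flip: of_nat_sum)
qed (simp_all add: finite_verts srw_step_def)

lemmas kernel = srw.finite_markov_kernel_axioms

lemma srw_step_outside: "y \<notin> verts H \<Longrightarrow> srw_step H x y = 0"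
  by (simp add: srw_step_def edge_mult_outside wf)

lemma card_le_vol: "card (verts H) \<le> vol H (verts H)"
  using sum_mono[of "verts H" "\<lambda>_. 1" "deg H"] deg_ge_1 unfolding vol_def by simp

lemma vol_pos: "x \<in> verts H \<Longrightarrow> vol H (verts H) \<ge> 1"
  using card_le_vol finite_verts by (metis One_nat_def Suc_leI card_gt_0_iff empty_iff le_trans)

text \<open>The degree is a reversible weight whose total is the volume, and the loop supplies the
  holding probability.\<close>

lemma return_prob_ge:
  assumes x: "x \<in> verts H"
  shows "srw.kpow k x x \<ge> 1 / real (vol H (verts H))"
  unfolding vol_def of_nat_sum
proof (rule srw.kpow_return_ge[OF _ deg_ge_1 x])
  fix x y assume "x \<in> verts H" "y \<in> verts H"
  then show "real (deg H x) * srw_step H x y = real (deg H y) * srw_step H y x"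
    using deg_ge_1 edge_mult_commute[of H x y] by (fastforce simp: srw_step_def)
next
  show "1 / real (deg H x) \<le> srw_step H x x"
    unfolding srw_step_def using loop[OF x] by (intro divide_right_mono) auto
qed

end

text \<open>The walks on \<open>G\<close> and \<open>H\<close> move alike in the interior of
  \<open>K\<close>, so the laws \<open>P u\<close> of the former provide the killed masses of the
  latter. Each of the \<open>n - 2 * m\<close> times of the window then contributes at least the
  inverse volume.\<close>

lemma visits_ge_volume:
  fixes G H K :: "('v, 'e) multigraph" and x y :: 'v and P :: "'v \<Rightarrow> 'u measure" and Y :: "nat \<Rightarrow> 'u \<Rightarrow> 'v"
  defines "B \<equiv> inner_boundary G K"
  assumes G: "wf_graph G" and K: "subgraph K H" "edges_induced K G"
    and H: "subgraph H G" "lazy_finite_graph H"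
    and xy: "x \<in> verts K" "y \<in> verts K"
    and P: "\<And>u. u \<in> verts K \<Longrightarrow> markov_chain_from (P u) Y S (\<lambda>_. srw_step G) u"
    and tail: "\<And>u. u \<in> verts K \<Longrightarrow> measure (P u) {\<omega> \<in> space (P u).
      ereal_of_enat (hitting_time B (\<lambda>t. Y t \<omega>)) > ereal \<theta>} \<le> \<delta>"
    and m: "\<theta> \<le> real m"
    and ratio: "\<And>z. z \<in> B \<Longrightarrow>
      c * measure (P x) {\<omega> \<in> space (P x). \<exists>t. hitting_time B (\<lambda>t. Y t \<omega>) = enat t \<and> Y t \<omega> = z}
      \<le> measure (P y) {\<omega> \<in> space (P y). \<exists>t. hitting_time B (\<lambda>t. Y t \<omega>) = enat t \<and> Y t \<omega> = z}"
    and c: "c > 0" and \<delta>: "\<delta> * (1 + 1 / c) \<le> 1 / 2"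
  shows "c / 2 * ((real n - 2 * real m) / real (vol H (verts H))) - (1 + c) * \<delta> * real m
    \<le> finite_markov_kernel.visits (verts H) (srw_step H) x n y"
proof -
  interpret lazy_finite_graph H by fact
  define I where "I = verts K - B"
  have sub: "verts K \<subseteq> verts H" using K by (simp add: subgraph_def)
  have IB: "I \<union> B = verts K" "I \<inter> B = {}" by (auto simp: I_def B_def inner_boundary_def)
  have fin: "finite I" "finite B"
    using finite_subset[OF sub finite_verts] unfolding IB(1)[symmetric] by simp_all
  have chain: "killed_markov_chain (P u) Y S (\<lambda>_. srw_step G) u I B" if "u \<in> verts K" for u
    by unfold_locales (use P[OF that] fin IB in auto)
  define \<beta> where "\<beta> u = path_prob (P u) Y (\<lambda>_. I)" for u
  have killed: "killed_kernel (verts H) (srw_step H) I B u (\<beta> u)" if u: "u \<in> verts K" for u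
  proof unfold_locales
    show "I \<inter> B = {}" "I \<union> B \<subseteq> verts H" "u \<in> I \<union> B" using IB sub u by auto
    show "srw_step H a w = 0" if "a \<in> I" "w \<in> verts H - (I \<union> B)" for a w
    proof -
      have "edge_mult G a w = 0"
        using edge_mult_nonzero_interior[OF G, of a K w] that IB by (auto simp: I_def B_def)
      then show ?thesis
        using edge_mult_interior[OF G K(1) H(1) K(2), of a w] that by (auto simp: I_def B_def srw_step_def)
    qed
    show "\<beta> u 0 w = of_bool (w = u)" for w
      unfolding \<beta>_def by (rule path_prob_0[OF P[OF u]])
    show "\<beta> u (Suc k) w = (\<Sum>a\<in>I. \<beta> u k a * srw_step H a w)" for k w
    proof -
      have "srw_step H a w = srw_step G a w" if "a \<in> I" for a
        using edge_mult_interior[OF G K(1) H(1) K(2), of a w] deg_interior[OF G K(1) H(1) K(2), of a] that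
        by (simp add: srw_step_def I_def B_def)
      then show ?thesis
        unfolding \<beta>_def path_prob_Suc[OF P[OF u] fin(1)] by simp
    qed
    show "\<beta> u k w \<ge> 0" for k w by (simp add: \<beta>_def path_prob_nonneg)
  qed
  have surv: "(\<Sum>w\<in>I. \<beta> u m w) \<le> \<delta>" if "u \<in> verts K" for u
    unfolding \<beta>_def
    using killed_markov_chain.survival_le[OF chain[OF that] m] tail[OF that] by (rule order_trans)
  have \<delta>0: "\<delta> \<ge> 0" using order_trans[OF measure_nonneg tail[OF xy(1)]] .
  show ?thesis
  proof (cases "2 * m \<le> n")
    case False
    \<comment> \<open>The window is empty here and the claimed lower bound is at most 0.\<close>
    then have "real n - 2 * real m \<le> 0" by simp
    then have "c / 2 * ((real n - 2 * real m) / real (vol H (verts H))) \<le> 0"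
      using c by (intro mult_nonneg_nonpos divide_nonpos_nonneg) auto
    moreover have "(1 + c) * \<delta> * real m \<ge> 0" using c \<delta>0 by simp
    moreover have "srw.visits x n y \<ge> 0" by (rule srw.visits_nonneg)
    ultimately show ?thesis by linarith
  next
    case True
    \<comment> \<open>The probability, from \<open>y\<close>, of an exit at \<open>z\<close> by a
      path still in \<open>I\<close> at time \<open>m\<close>; \<open>late_exit_le\<close> bounds
      its sum over \<open>z\<close> by the survival probability.\<close>
    define r where "r z = measure (P y) {\<omega> \<in> {\<omega> \<in> space (P y). \<exists>t. hitting_time B (\<lambda>t. Y t \<omega>) = enat t \<and> Y t \<omega> = z}.
      (\<forall>s<m. Y s \<omega> \<in> I) \<and> Y m \<omega> \<in> I}" for z
    have "c / 2 * (\<Sum>k=m..<n - m. srw.kpow k x x) - (1 + c) * \<delta> * real m \<le> srw.visits x n y"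
    proof (rule visits_comparison[OF killed[OF xy(1)] killed[OF xy(2)]])
      show "sum r B \<le> \<delta>"
        unfolding r_def
        using killed_markov_chain.late_exit_le[OF chain[OF xy(2)]] surv[OF xy(2)] unfolding \<beta>_def
        by (rule order_trans)
      show "c * (\<Sum>j\<le>m. \<beta> x j z) \<le> (\<Sum>j\<le>m. \<beta> y j z) + r z" if z: "z \<in> B" for z
      proof -
        have "c * (\<Sum>j\<le>m. \<beta> x j z) \<le>
            c * measure (P x) {\<omega> \<in> space (P x). \<exists>t. hitting_time B (\<lambda>t. Y t \<omega>) = enat t \<and> Y t \<omega> = z}"
          unfolding \<beta>_def using killed_markov_chain.partial_exit_le[OF chain[OF xy(1)] z] c by simp
        also note ratio[OF z]
        also have "measure (P y) {\<omega> \<in> space (P y). \<exists>t. hitting_time B (\<lambda>t. Y t \<omega>) = enat t \<and> Y t \<omega> = z}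
            \<le> (\<Sum>j\<le>m. \<beta> y j z) + r z"
          unfolding \<beta>_def r_def
          by (rule killed_markov_chain.exit_le_partial[OF chain[OF xy(2)]])
            (use killed_kernel.total_mass[OF killed[OF xy(2)]] in \<open>simp add: \<beta>_def\<close>)
        finally show ?thesis .
      qed
    qed (use True \<delta> c surv xy sub in \<open>auto simp: r_def\<close>)
    moreover have "(real n - 2 * real m) / real (vol H (verts H)) \<le> (\<Sum>k=m..<n - m. srw.kpow k x x)"
    proof -
      have "(real n - 2 * real m) / real (vol H (verts H)) = (\<Sum>k=m..<n - m. 1 / real (vol H (verts H)))"
        using True by simp
      also have "\<dots> \<le> (\<Sum>k=m..<n - m. srw.kpow k x x)"
        by (intro sum_mono return_prob_ge) (use xy sub in auto)
      finally show ?thesis .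
    qed
    then have "c / 2 * ((real n - 2 * real m) / real (vol H (verts H))) \<le> c / 2 * (\<Sum>k=m..<n - m. srw.kpow k x x)"
      using c by (intro mult_left_mono) auto
    ultimately show ?thesis by linarith
  qed
qed

text \<open>The hitting time is 0, so the law is a point mass. A ratio bound between two such laws
  forces the starting points to coincide.\<close>

lemma hitting_law_on_boundary:
  assumes mc: "markov_chain_from M Y S p x" and x: "x \<in> B"
  shows "measure M {\<omega> \<in> space M. \<exists>t. hitting_time B (\<lambda>t. Y t \<omega>) = enat t \<and> Y t \<omega> = z} = of_bool (z = x)"
proof -
  \<comment> \<open>This supplies the probability space and measurability. As \<open>B\<close> may
    be infinite, trivial finite sets stand in for it.\<close>
  interpret killed_markov_chain M Y S p x "{}" "{x}" by unfold_locales (use mc in auto)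
  have ae: "AE \<omega> in M. Y 0 \<omega> = x" using mc by (simp add: markov_chain_from_def)
  have eq: "(\<exists>t. hitting_time B (\<lambda>t. Y t \<omega>) = enat t \<and> Y t \<omega> = z) \<longleftrightarrow> z = x" if "Y 0 \<omega> = x" for \<omega>
  proof -
    have "hitting_time B (\<lambda>t. Y t \<omega>) = enat 0" using that x by (simp add: hitting_time_eq_enat_iff)
    then show ?thesis using that by auto
  qed
  have meas: "{\<omega> \<in> space M. \<exists>t. hitting_time B (\<lambda>t. Y t \<omega>) = enat t \<and> Y t \<omega> = z} \<in> sets M"
    unfolding hitting_time_eq_enat_iff by measurable
  show ?thesis
  proof (cases "z = x")
    case True
    have "measure M {\<omega> \<in> space M. \<exists>t. hitting_time B (\<lambda>t. Y t \<omega>) = enat t \<and> Y t \<omega> = z} = 1"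
      by (subst prob_Collect_eq_1[OF meas]) (use ae in eventually_elim, use eq True in blast)
    then show ?thesis using True by simp
  next
    case False
    have "measure M {\<omega> \<in> space M. \<exists>t. hitting_time B (\<lambda>t. Y t \<omega>) = enat t \<and> Y t \<omega> = z} = 0"
      by (subst prob_Collect_eq_0[OF meas]) (use ae in eventually_elim, use eq False in blast)
    then show ?thesis using False by simp
  qed
qed

text \<open>Step \<open>t\<close> uses the kernel on \<open>V t\<close>, so at time
  \<open>Suc t\<close> the chain is still in \<open>V t\<close>, not merely in
  \<open>V (Suc t)\<close>. The second conclusion records this.\<close>

lemma path_prob_mass:
  assumes mc: "markov_chain_from M X S p x" and x: "x \<in> V 0"
    and V: "\<And>t. finite (V t)" "\<And>t. V t \<subseteq> V (Suc t)"
    and p: "\<And>t x. x \<in> V t \<Longrightarrow> (\<Sum>y\<in>V t. p t x y) = 1" "\<And>t x y. y \<notin> V t \<Longrightarrow> p t x y = 0"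
  shows "(\<Sum>w\<in>V t. path_prob M X V t w) = 1" "(\<Sum>w\<in>V t. path_prob M X V (Suc t) w) = 1"
proof -
  have step: "(\<Sum>w\<in>W. path_prob M X V (Suc t) w) = 1"
    if "(\<Sum>w\<in>V t. path_prob M X V t w) = 1" "V t \<subseteq> W" "finite W" for t W
  proof -
    have "(\<Sum>y\<in>W. p t x y) = (\<Sum>y\<in>V t. p t x y)" for x
      by (rule sum.mono_neutral_right) (use that p(2) in auto)
    then have "(\<Sum>w\<in>W. path_prob M X V (Suc t) w) = (\<Sum>x\<in>V t. path_prob M X V t x * (\<Sum>y\<in>V t. p t x y))"
      unfolding path_prob_Suc[OF mc V(1)] by (subst sum.swap) (simp add: sum_distrib_left[symmetric])
    also have "\<dots> = 1" using p(1) that(1) by simp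
    finally show ?thesis .
  qed
  show "(\<Sum>w\<in>V t. path_prob M X V t w) = 1"
  proof (induction t)
    case 0
    then show ?case using path_prob_0[OF mc] x V(1) by (simp add: of_bool_def)
  next
    case (Suc t)
    then show ?case using step V by blast
  qed
  then show "(\<Sum>w\<in>V t. path_prob M X V (Suc t) w) = 1" using step V(1) by blast
qed

text \<open>The phase begins at time \<open>Suc b\<close>, when the chain still sits in
  \<open>V b\<close>, so a bound for starts in \<open>V b\<close> is enough. It is averaged with
  weights of total mass exactly 1, which also admits a negative \<open>e\<close>.\<close>

lemma phase_visits_ge:
  assumes mc: "markov_chain_from M X S p x" and x: "x \<in> V 0"
    and V: "\<And>t. finite (V t)" "\<And>t. V t \<subseteq> V (Suc t)"
    and p: "\<And>t x. x \<in> V t \<Longrightarrow> (\<Sum>y\<in>V t. p t x y) = 1" "\<And>t x y. y \<notin> V t \<Longrightarrow> p t x y = 0"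
    and H: "finite_markov_kernel U q"
    and frozen: "\<And>k. k < n \<Longrightarrow> V (Suc b + k) = U \<and> p (Suc b + k) = q"
    and o: "o\<^sub>0 \<in> U" and lower: "\<And>y. y \<in> V b \<Longrightarrow> e \<le> finite_markov_kernel.visits U q o\<^sub>0 n y"
    and n: "n > 0"
  shows "e \<le> (\<Sum>k<n. path_prob M X V (Suc b + k) o\<^sub>0)"
proof -
  interpret finite_markov_kernel U q by fact
  define \<alpha> where "\<alpha> = path_prob M X V"
  have bU: "V b \<subseteq> U" using V(2)[of b] frozen[OF n] by simp
  have "\<alpha> (Suc b + k) w = (\<Sum>y\<in>U. \<alpha> (Suc b) y * kpow k y w)" if "k < n" "w \<in> U" for k w
    using that
  proof (induction k arbitrary: w)
    case 0
    then show ?case using fin by (simp add: of_bool_def if_distrib cong: if_cong)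
  next
    case (Suc k)
    have "\<alpha> (Suc b + Suc k) w = (\<Sum>z\<in>U. \<alpha> (Suc b + k) z * q z w)"
      using path_prob_Suc[OF mc, of V "Suc b + k" w] V(1) frozen[of k] Suc.prems by (simp add: \<alpha>_def)
    also have "\<dots> = (\<Sum>z\<in>U. \<Sum>y\<in>U. \<alpha> (Suc b) y * kpow k y z * q z w)"
      using Suc by (simp add: sum_distrib_right)
    also have "\<dots> = (\<Sum>y\<in>U. \<Sum>z\<in>U. \<alpha> (Suc b) y * kpow k y z * q z w)" by (rule sum.swap)
    also have "\<dots> = (\<Sum>y\<in>U. \<alpha> (Suc b) y * kpow (Suc k) y w)"
      using Suc.prems by (intro sum.cong refl) (simp only: kpow_Suc_right sum_distrib_left mult.assoc)
    finally show ?case .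
  qed
  then have "(\<Sum>k<n. \<alpha> (Suc b + k) o\<^sub>0) = (\<Sum>k<n. \<Sum>y\<in>U. \<alpha> (Suc b) y * kpow k y o\<^sub>0)"
    using o by simp
  also have "\<dots> = (\<Sum>y\<in>U. \<alpha> (Suc b) y * visits o\<^sub>0 n y)"
    unfolding visits_def by (subst sum.swap) (simp add: sum_distrib_left)
  \<comment> \<open>Starts in \<open>U\<close> outside \<open>V b\<close> contribute nonnegative
    terms and are dropped.\<close>
  also have "\<dots> \<ge> (\<Sum>y\<in>V b. \<alpha> (Suc b) y * visits o\<^sub>0 n y)"
    by (rule sum_mono2) (use bU fin visits_nonneg path_prob_nonneg in \<open>auto simp: \<alpha>_def intro!: mult_nonneg_nonneg\<close>)
  also have "(\<Sum>y\<in>V b. \<alpha> (Suc b) y * visits o\<^sub>0 n y) \<ge> (\<Sum>y\<in>V b. \<alpha> (Suc b) y * e)"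
    by (intro sum_mono mult_left_mono lower) (auto simp: \<alpha>_def path_prob_nonneg)
  also have "(\<Sum>y\<in>V b. \<alpha> (Suc b) y * e) = e"
    using path_prob_mass(2)[OF mc x V p, of b] by (simp add: \<alpha>_def sum_distrib_right[symmetric])
  finally show ?thesis by (simp add: \<alpha>_def)
qed

subsection \<open>Recurrence\<close>

text \<open>With \<open>s\<close> a multiple of \<open>ln v\<close>, the tail \<delta> is of order
  \<open>1 / v\<^sup>2\<close>, and \<open>m\<close> is of order
  \<open>v / ln v powr (1 + \<epsilon>)\<close>. Since \<open>ln v\<close> grows at least linearly
  in \<open>l\<close>, a multiple of \<open>l powr (- 1 - \<epsilon>)\<close> plus a geometric term
  dominates \<open>m / v\<close>, and a geometric sequence dominates
  \<open>\<delta> * m\<close>.\<close>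

lemma exponential_growth_scales:
  fixes v :: "nat \<Rightarrow> real"
  assumes growth: "liminf (\<lambda>l. ereal (ln (v l) / real l)) > 0" and v0: "\<And>l. v l \<ge> 0"
    and \<epsilon>: "\<epsilon> > 0" and d: "d > 0"
  obtains m :: "nat \<Rightarrow> nat" and s \<delta> :: "nat \<Rightarrow> real"
  where "summable (\<lambda>l. real (m l) / v l)" "summable (\<lambda>l. \<delta> l * real (m l))" "\<delta> \<longlonglongrightarrow> 0"
    "\<And>l. \<delta> l = inverse d * exp (- d * s l)"
    "\<forall>\<^sub>F l in sequentially. s l \<ge> 1 \<and> v l > 0 \<and> s l * v l / ln (v l) powr (2 + \<epsilon>) \<le> real (m l)"
proof -
  obtain a where a: "0 < ereal a" "ereal a < liminf (\<lambda>l. ereal (ln (v l) / real l))"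
    using growth ereal_dense2 by blast
  have ev: "\<forall>\<^sub>F l in sequentially. a < ln (v l) / real l"
    using less_LiminfD[OF a(2)] by simp
  have "a > 0" using a by simp
  \<comment> \<open>Chosen so that \<open>d * s l = 2 * ln (v l)\<close>.\<close>
  define C where "C = 2 / d"
  define s where "s l = C * ln (v l)" for l
  define \<delta> where "\<delta> l = inverse d * exp (- d * s l)" for l
  define m where "m l = nat \<lceil>C * v l / ln (v l) powr (1 + \<epsilon>)\<rceil>" for l
  have "C > 0" using d by (simp add: C_def)
  \<comment> \<open>Beyond \<open>l0\<close> the numbers \<open>l\<close>, \<open>a * l\<close> and
    \<open>C * a * l\<close> are at least 1; the last two give \<open>ln (v l) \<ge> 1\<close> and
    \<open>s l \<ge> 1\<close>.\<close>
  define l0 where "l0 = max 1 (max (1 / a) (1 / (C * a)))"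
  have good: "\<forall>\<^sub>F l in sequentially. l > 0 \<and> v l > 0 \<and> ln (v l) \<ge> a * real l \<and> ln (v l) \<ge> 1 \<and> s l \<ge> 1"
    using ev eventually_ge_at_top[of "nat \<lceil>l0\<rceil>"]
  proof eventually_elim
    case (elim l)
    have "real l \<ge> l0" using elim(2) by linarith
    then have l: "real l \<ge> 1" "real l \<ge> 1 / a" "real l \<ge> 1 / (C * a)" by (auto simp: l0_def)
    have L: "ln (v l) \<ge> a * real l" using elim(1) l(1) by (simp add: field_simps)
    have "a * real l \<ge> 1" using l(2) \<open>a > 0\<close> by (simp add: field_simps)
    then have L1: "ln (v l) \<ge> 1" using L by linarith
    then have "v l \<noteq> 0" by auto
    then have "v l > 0" using v0[of l] by simp
    moreover have "C * (a * real l) \<ge> 1" using l(3) \<open>a > 0\<close> \<open>C > 0\<close> by (simp add: field_simps)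
    then have "s l \<ge> 1" unfolding s_def using L \<open>C > 0\<close> by (meson mult_left_mono order_trans less_imp_le)
    ultimately show ?case using L L1 l(1) by auto
  qed
  have inv: "1 / v l \<le> exp (- a * real l)" if "v l > 0" "ln (v l) \<ge> a * real l" for l
  proof -
    have "exp (a * real l) \<le> v l" using that by (simp add: ln_ge_iff)
    then have "1 / v l \<le> 1 / exp (a * real l)" by (intro divide_left_mono) (use that in auto)
    then show ?thesis by (simp add: exp_minus field_simps)
  qed
  \<comment> \<open>The summand 1 pays for rounding up. After division by \<open>v l\<close> it is
    summable by exponential growth.\<close>
  have m_le: "real (m l) \<le> C * v l / ln (v l) powr (1 + \<epsilon>) + 1" if "v l > 0" for l
  proof -
    have "C * v l / ln (v l) powr (1 + \<epsilon>) \<ge> 0" using that \<open>C > 0\<close> by simp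
    then show ?thesis unfolding m_def by linarith
  qed
  have sexp: "summable (\<lambda>l. exp (- a * real l))"
  proof -
    have "summable (\<lambda>l. exp (- a) ^ l)" using \<open>a > 0\<close> by (intro summable_geometric) simp
    then show ?thesis by (simp add: exp_of_nat_mult[symmetric] mult.commute)
  qed
  have spow: "summable (\<lambda>l. C * a powr (- 1 - \<epsilon>) * real l powr (- 1 - \<epsilon>))"
    using \<epsilon> by (intro summable_mult) (simp add: summable_real_powr_iff)
  have "summable (\<lambda>l. real (m l) / v l)"
  proof (rule summable_comparison_test_ev[OF _ summable_add[OF spow sexp]])
    show "\<forall>\<^sub>F l in sequentially. norm (real (m l) / v l)
        \<le> C * a powr (- 1 - \<epsilon>) * real l powr (- 1 - \<epsilon>) + exp (- a * real l)"
      using good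
    proof eventually_elim
      case (elim l)
      have al: "a * real l > 0" using \<open>a > 0\<close> elim by simp
      have "real (m l) / v l \<le> (C * v l / ln (v l) powr (1 + \<epsilon>) + 1) / v l"
        using m_le[of l] elim by (intro divide_right_mono) auto
      also have "\<dots> = C * ln (v l) powr (- 1 - \<epsilon>) + 1 / v l"
        using elim powr_minus_divide[of "ln (v l)" "1 + \<epsilon>"] by (simp add: field_simps)
      also have "\<dots> \<le> C * (a * real l) powr (- 1 - \<epsilon>) + exp (- a * real l)"
        using elim inv[of l] al \<open>C > 0\<close> \<epsilon> by (intro add_mono mult_left_mono powr_mono2') auto
      also have "(a * real l) powr (- 1 - \<epsilon>) = a powr (- 1 - \<epsilon>) * real l powr (- 1 - \<epsilon>)"
        using \<open>a > 0\<close> by (simp add: powr_mult)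
      finally show ?case using elim by (simp add: mult.assoc)
    qed
  qed
  moreover have \<delta>_eq: "\<delta> l = inverse d * (1 / v l) * (1 / v l)" if "v l > 0" for l
  proof -
    have "exp (- d * s l) = exp (- (ln (v l) + ln (v l)))"
      unfolding s_def C_def using d by simp
    also have "\<dots> = (1 / v l) * (1 / v l)"
      using that by (simp only: minus_add_distrib exp_add) (simp add: exp_minus field_simps)
    finally show ?thesis by (simp add: \<delta>_def)
  qed
  moreover have "summable (\<lambda>l. \<delta> l * real (m l))"
  proof (rule summable_comparison_test_ev[OF _ summable_mult[OF sexp, of "inverse d * (C + 1)"]])
    show "\<forall>\<^sub>F l in sequentially. norm (\<delta> l * real (m l)) \<le> inverse d * (C + 1) * exp (- a * real l)"
      using good
    proof eventually_elim
      case (elim l)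
      have v1: "v l \<ge> 1" using elim by (smt (verit) ln_le_zero_iff)
      have "ln (v l) powr (1 + \<epsilon>) \<ge> 1" using elim \<epsilon> by (simp add: ge_one_powr_ge_zero)
      then have "C * v l / ln (v l) powr (1 + \<epsilon>) \<le> C * v l / 1"
        using \<open>C > 0\<close> elim by (intro divide_left_mono) auto
      then have "real (m l) \<le> (C + 1) * v l" using m_le[of l] elim v1 by (simp add: algebra_simps)
      then have "\<delta> l * real (m l) \<le> \<delta> l * ((C + 1) * v l)"
        using d by (intro mult_left_mono) (auto simp: \<delta>_def)
      also have "\<dots> = inverse d * (C + 1) * (1 / v l)" using elim by (simp add: \<delta>_eq)
      also have "\<dots> \<le> inverse d * (C + 1) * exp (- a * real l)"
        using inv[of l] elim d \<open>C > 0\<close> by (intro mult_left_mono) auto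
      finally show ?case using d by (simp add: \<delta>_def)
    qed
  qed
  moreover have "\<delta> \<longlonglongrightarrow> 0"
  proof (rule Lim_null_comparison)
    show "\<forall>\<^sub>F l in sequentially. norm (\<delta> l) \<le> inverse d * exp (- a * real l)"
      using good
    proof eventually_elim
      case (elim l)
      have v1: "1 / v l \<le> 1" using elim by (smt (verit) ln_le_zero_iff divide_le_eq_1)
      have "\<delta> l = inverse d * ((1 / v l) * (1 / v l))" using elim by (simp add: \<delta>_eq)
      also have "\<dots> \<le> inverse d * (exp (- a * real l) * 1)"
        using v1 inv[of l] elim d by (intro mult_left_mono mult_mono) auto
      finally show ?case using d by (simp add: \<delta>_def)
    qed
    show "(\<lambda>l. inverse d * exp (- a * real l)) \<longlonglongrightarrow> 0"
      by (rule tendsto_mult_right_zero[OF summable_LIMSEQ_zero[OF sexp]])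
  qed
  moreover have "\<forall>\<^sub>F l in sequentially. s l \<ge> 1 \<and> v l > 0 \<and> s l * v l / ln (v l) powr (2 + \<epsilon>) \<le> real (m l)"
    using good
  proof eventually_elim
    case (elim l)
    have "ln (v l) \<ge> 0" using elim by linarith
    then have "ln (v l) powr (2 + \<epsilon>) = ln (v l) * ln (v l) powr (1 + \<epsilon>)"
      by (subst powr_mult_base) simp_all
    then have "s l * v l / ln (v l) powr (2 + \<epsilon>) = C * v l / ln (v l) powr (1 + \<epsilon>)"
      using elim by (simp add: s_def)
    also have "\<dots> \<le> real (m l)" unfolding m_def by (rule of_nat_ceiling)
    finally show ?case using elim by simp
  qed
  ultimately show ?thesis using that \<delta>_def by blast
qed

theorem proposition1p18:
  fixes G :: "('v, 'e) multigraph"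
    and E :: "nat \<Rightarrow> 'e set"
    and Gt :: "nat \<Rightarrow> ('v, 'e) multigraph"
    and M :: "'w measure" and X :: "nat \<Rightarrow> 'w \<Rightarrow> 'v" and x\<^sub>0 :: 'v
    and P :: "'v \<Rightarrow> 'u measure" and Y :: "nat \<Rightarrow> 'u \<Rightarrow> 'v"
    and T :: "nat \<Rightarrow> nat"
    and Klow Kup :: "nat \<Rightarrow> ('v, 'e) multigraph"
    and \<tau> :: "nat \<Rightarrow> 'u \<Rightarrow> enat"
    and v :: "nat \<Rightarrow> real" and vK :: "nat \<Rightarrow> real"
    and c\<^sub>R\<^sub>N \<epsilon> c\<^sub>E \<Delta> :: real
  defines "Gt \<equiv> \<lambda>t. snapshot G (E t)"
    and "v \<equiv> \<lambda>t. real (vol (Gt t) (verts (Gt t)))"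
    and "vK \<equiv> \<lambda>l. real (vol G (verts (Klow l)))"
    and "\<tau> \<equiv> \<lambda>l \<omega>. hitting_time (inner_boundary G (Klow l)) (\<lambda>t. Y t \<omega>)"
  assumes G: "wf_graph G" "infinite (verts G)" "locally_finite G" "graph_connected G"
    and E_edges: "\<And>t. E t \<subseteq> edges G"
    and E_incr: "\<And>t. E t \<subseteq> E (Suc t)"
    and Gt: "\<And>t. finite (verts (Gt t))" "\<And>t. graph_connected (Gt t)"
    and x0: "x\<^sub>0 \<in> verts (Gt 0)"
    and X: "markov_chain_from M X (verts G) (\<lambda>t. srw_step (Gt t)) x\<^sub>0"
    and P: "\<And>x. x \<in> verts G \<Longrightarrow> markov_chain_from (P x) Y (verts G) (\<lambda>_. srw_step G) x"
    and T: "T 0 = 0" "mono T"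
    and Klow: "\<And>l. subgraph (Klow l) G" "\<And>l. finite (verts (Klow l))"
      "\<And>l. graph_connected (Klow l)" "\<And>l. subgraph (Klow l) (Klow (Suc l))"
    and Kup: "\<And>l. subgraph (Kup l) G" "\<And>l. finite (verts (Kup l))"
      "\<And>l. graph_connected (Kup l)" "\<And>l. subgraph (Kup l) (Kup (Suc l))"
    and a_nested: "\<And>l. l \<ge> 1 \<Longrightarrow> subgraph (Kup (l - 1)) (Klow l)"
      "\<And>l. subgraph (Klow l) (Kup l)"
    and a_induced: "\<And>l. edges_induced (Klow l) G" "\<And>l. edges_induced (Kup l) G"
    and a_frozen: "\<And>l t. T l \<le> t \<Longrightarrow> t < T (Suc l) \<Longrightarrow>
      subgraph (Klow l) (Gt t) \<and> Gt t = Gt (T l) \<and> subgraph (Gt t) (Kup l)"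
    and b_pos: "c\<^sub>R\<^sub>N > 0"
    and b_ratio: "\<And>l x y z. l \<ge> 1 \<Longrightarrow> x \<in> verts (Kup (l - 1)) \<Longrightarrow> y \<in> verts (Kup (l - 1)) \<Longrightarrow>
      z \<in> inner_boundary G (Klow l) \<Longrightarrow>
      c\<^sub>R\<^sub>N * measure (P y) {\<omega> \<in> space (P y). \<exists>t. \<tau> l \<omega> = enat t \<and> Y t \<omega> = z}
        \<le> measure (P x) {\<omega> \<in> space (P x). \<exists>t. \<tau> l \<omega> = enat t \<and> Y t \<omega> = z} \<and>
      measure (P x) {\<omega> \<in> space (P x). \<exists>t. \<tau> l \<omega> = enat t \<and> Y t \<omega> = z}
        \<le> inverse c\<^sub>R\<^sub>N * measure (P y) {\<omega> \<in> space (P y). \<exists>t. \<tau> l \<omega> = enat t \<and> Y t \<omega> = z}"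
    and b_growth: "liminf (\<lambda>l. ereal (ln (vK l) / real l)) > 0"
    and c_pos: "\<epsilon> > 0" "c\<^sub>E > 0"
    and c_tail: "\<And>l s. s \<ge> (1::real) \<Longrightarrow>
      (SUP x\<in>verts (Klow l). measure (P x) {\<omega> \<in> space (P x).
          ereal_of_enat (\<tau> l \<omega>) > ereal (s * vK l / ln (vK l) powr (2 + \<epsilon>))})
        < inverse c\<^sub>E * exp (- c\<^sub>E * s)"
    and loops: "\<And>t x. x \<in> verts (Gt t) \<Longrightarrow> edge_mult (Gt t) x x \<ge> 1"
    and bounded: "\<And>t x. x \<in> verts (Gt t) \<Longrightarrow> real (deg (Gt t) x) \<le> \<Delta>"
    and sums: "(\<Sum>t. ennreal (1 / v t)) =
        (\<Sum>l. ennreal ((real (T (Suc l)) - real (T l)) / v (T l)))"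
      "(\<Sum>l. ennreal ((real (T (Suc l)) - real (T l)) / v (T l))) = \<infinity>"
  shows "weakly_recurrent M X x\<^sub>0"
proof (rule ccontr)
  assume not_rec: "\<not> weakly_recurrent M X x\<^sub>0"
  interpret M: prob_space M using X by (simp add: markov_chain_from_def)

  \<comment> \<open>The growing graphs and the nested subgraphs\<close>
  define V where "V t = verts (Gt t)" for t
  have V: "finite (V t)" "V t \<subseteq> V (Suc t)" for t
    using Gt(1) verts_snapshot_mono[OF E_incr, of G] by (auto simp: V_def Gt_def)
  have lazy: "lazy_finite_graph (Gt t)" for t
    using Gt(1) loops by unfold_locales (auto simp: Gt_def wf_graph_snapshot)
  have sub_G: "subgraph (Gt t) G" for t
    unfolding Gt_def by (rule subgraph_snapshot[OF E_edges])
  have x0_V: "x\<^sub>0 \<in> V t" for t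
    using x0 V(2) by (induction t) (auto simp: V_def)
  have v_ge_1: "v t \<ge> 1" for t
    using lazy_finite_graph.vol_pos[OF lazy, of x\<^sub>0 t] x0_V[of t] by (simp add: v_def V_def)
  have Klow_mono: "subgraph (Klow i) (Klow j)" if "i \<le> j" for i j
    using that
  proof (induction rule: dec_induct)
    case base
    show ?case using Klow(1)[of i] by (simp add: subgraph_def)
  next
    case (step k)
    show ?case by (rule subgraph_trans[OF step.IH Klow(4)])
  qed
  have Kup_mono: "verts (Kup i) \<subseteq> verts (Kup j)" if "i \<le> j" for i j
    using that
  proof (induction rule: dec_induct)
    case (step k)
    then show ?case using Kup(4)[of k] by (auto simp: subgraph_def)
  qed simp

  \<comment> \<open>Phases and their lengths\<close>
  define n where "n l = T (Suc l) - T l" for l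
  have n: "real (n l) = real (T (Suc l)) - real (T l)" for l
    using T(2) by (simp add: n_def monoD of_nat_diff)
  have T_Suc: "T (Suc l) = T l + n l" for l
    using monoD[OF T(2), of l "Suc l"] by (simp add: n_def)
  have group: "(\<Sum>l<N. \<Sum>k<n l. f (T l + k)) = (\<Sum>t<T N. f t)" for f :: "nat \<Rightarrow> real" and N
  proof (induction N)
    case (Suc N)
    have "(\<Sum>t<T N + b. f t) = (\<Sum>t<T N. f t) + (\<Sum>k<b. f (T N + k))" for b
      by (induction b) auto
    then show ?case using Suc by (simp add: T_Suc)
  qed (simp add: T(1))
  have ratio_nonneg: "real (n l) / v (T l) \<ge> 0" for l
    using v_ge_1[of "T l"] by simp
  have ratio_not_summable: "\<not> summable (\<lambda>l. real (n l) / v (T l))"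
  proof
    assume "summable (\<lambda>l. real (n l) / v (T l))"
    then have "(\<Sum>l. ennreal (real (n l) / v (T l))) \<noteq> \<infinity>"
      using ratio_nonneg by (subst suminf_ennreal2) auto
    then show False using sums(2) by (simp add: n)
  qed
  \<comment> \<open>Since \<open>v \<ge> 1\<close>, the partial sums over phases are at most the
    elapsed time \<open>T L\<close>, so a bounded \<open>T\<close> would make the divergent series
    converge.\<close>
  have T_unbounded: "\<exists>l. T l > N" for N
  proof (rule ccontr)
    assume bound: "\<nexists>l. T l > N"
    have "summable (\<lambda>l. real (n l) / v (T l))"
    proof (rule summableI_nonneg_bounded)
      show "0 \<le> real (n l) / v (T l)" for l by (rule ratio_nonneg)
      fix L
      have "real (n l) / v (T l) \<le> real (n l)" for l
        using v_ge_1[of "T l"] by (simp add: divide_le_eq mult_le_cancel_left1)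
      then have "(\<Sum>l<L. real (n l) / v (T l)) \<le> (\<Sum>l<L. \<Sum>k<n l. 1)"
        by (intro sum_mono) simp
      also have "\<dots> = real (T L)" using group[of "\<lambda>_. 1"] by simp
      also have "\<dots> \<le> real N" using bound by (simp add: not_less)
      finally show "(\<Sum>l<L. real (n l) / v (T l)) \<le> real N" .
    qed
    with ratio_not_summable show False by contradiction
  qed
  \<comment> \<open>\<open>T\<close> is only weakly increasing, so phases may be empty. The least
    \<open>j\<close> with \<open>t < T j\<close> ends the phase that contains
    \<open>t\<close>.\<close>
  have phase: "\<exists>l<L. T l \<le> t \<and> t < T (Suc l)" if "t < T L" for t L
  proof -
    define j where "j = (LEAST j. t < T j)"
    have "t < T j" "j \<le> L" unfolding j_def using that by (auto intro: LeastI Least_le)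
    moreover from this T(1) obtain l where "j = Suc l" by (cases j) auto
    moreover from this have "\<not> t < T l" unfolding j_def using not_less_Least by (metis lessI)
    ultimately show ?thesis by (intro exI[of _ l]) auto
  qed
  \<comment> \<open>Phase \<open>l\<close> may be empty; the phase that contains the time
    \<open>T l\<close> is not, and its index is at least \<open>l\<close>.\<close>
  have Klow_in_Gt: "\<exists>t. subgraph (Klow l) (Gt t)" for l
  proof -
    obtain L where L: "T l < T L" using T_unbounded by blast
    then obtain i where i: "i < L" "T i \<le> T l" "T l < T (Suc i)" using phase by blast
    have "l \<le> i"
    proof (rule ccontr)
      assume "\<not> l \<le> i"
      then have "T (Suc i) \<le> T l" using monoD[OF T(2), of "Suc i" l] by simp
      with i(3) show False by simp
    qed
    then show ?thesis using Klow_mono[of l i] a_frozen[OF i(2,3)] subgraph_trans by blast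
  qed

  (* A boundary vertex of Klow (l + 1) inside Kup l carries its whole exit law, so by the ratio bound
     there is at most one. Hence all but one of the vertices eventually lie in the interior of some
     Klow l, where their degree in G agrees with their degree in some Gt t. *)
  obtain D where D: "D \<ge> 0" "\<And>l x. x \<in> verts (Klow l) \<Longrightarrow> real (deg G x) \<le> D"
  proof -
    define W where "W = {x. (\<exists>l. x \<in> verts (Klow l)) \<and> real (deg G x) > \<Delta>}"
    have boundary: "x \<in> inner_boundary G (Klow l)" if x: "x \<in> W" "x \<in> verts (Klow l)" for x l
    proof (rule ccontr)
      assume "x \<notin> inner_boundary G (Klow l)"
      moreover obtain t where t: "subgraph (Klow l) (Gt t)" using Klow_in_Gt by blast
      ultimately have "deg (Gt t) x = deg G x"
        using deg_interior[OF G(1) t sub_G a_induced(1)] x by simp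
      moreover have "x \<in> verts (Gt t)" using t x by (auto simp: subgraph_def)
      ultimately show False using bounded[of x t] x by (simp add: W_def)
    qed
    have unique: "x = y" if xy: "x \<in> W" "y \<in> W" for x y
    proof -
      obtain i j where "x \<in> verts (Klow i)" "y \<in> verts (Klow j)" using xy by (auto simp: W_def)
      then obtain l where l: "x \<in> verts (Klow l)" "y \<in> verts (Klow l)"
        using Klow_mono[of i "max i j"] Klow_mono[of j "max i j"]
        by (auto simp: subgraph_def)
      have up: "x \<in> verts (Kup (Suc l - 1))" "y \<in> verts (Kup (Suc l - 1))"
        using l a_nested(2)[of l] by (auto simp: subgraph_def)
      have G': "x \<in> verts G" "y \<in> verts G" using l Klow(1)[of l] by (auto simp: subgraph_def)
      have bd: "x \<in> inner_boundary G (Klow (Suc l))" "y \<in> inner_boundary G (Klow (Suc l))"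
        using boundary[OF xy(1), of "Suc l"] boundary[OF xy(2), of "Suc l"] l Klow(4)[of l]
        by (auto simp: subgraph_def)
      have "(1::real) \<le> inverse c\<^sub>R\<^sub>N * of_bool (x = y)"
        using b_ratio[of "Suc l" x y x] up bd(1)
          hitting_law_on_boundary[OF P[OF G'(1)] bd(1), of x]
          hitting_law_on_boundary[OF P[OF G'(2)] bd(2), of x]
        by (simp add: \<tau>_def)
      then show ?thesis by (cases "x = y") auto
    qed
    show ?thesis
    proof (cases "W = {}")
      case True
      then show ?thesis by (intro that[of "max 0 \<Delta>"]) (auto simp: W_def not_less le_max_iff_disj)
    next
      case False
      then obtain u where "u \<in> W" by blast
      then have "real (deg G x) \<le> max (real (deg G u)) \<Delta>" if "x \<in> verts (Klow l)" for x l
        using unique[of x u] that by (cases "x \<in> W") (auto simp: W_def not_less le_max_iff_disj)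
      then show ?thesis by (intro that[of "max (real (deg G u)) \<Delta>"]) (auto simp: le_max_iff_disj)
    qed
  qed

  \<comment> \<open>\<open>vK\<close> sums degrees in \<open>G\<close>, \<open>v\<close> degrees in
    the current graph, and the two may differ on the boundary of \<open>Klow l\<close>. The
    comparison passes through numbers of vertices, with degrees at most \<open>D\<close> on one side
    and at least 1 on the other.\<close>
  have vK_le: "vK l \<le> D * v (T l)" if "n l > 0" for l
  proof -
    have "verts (Klow l) \<subseteq> V (T l)"
      using a_frozen[of l "T l"] that by (auto simp: n_def V_def subgraph_def)
    then have card: "card (verts (Klow l)) \<le> card (V (T l))" using V(1) card_mono by blast
    have "vK l \<le> (\<Sum>x\<in>verts (Klow l). D)"
      unfolding vK_def vol_def of_nat_sum by (intro sum_mono D(2))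
    also have "\<dots> = D * real (card (verts (Klow l)))" by simp
    also have "\<dots> \<le> D * v (T l)"
      using card lazy_finite_graph.card_le_vol[OF lazy, of "T l"] D(1)
      by (intro mult_left_mono) (simp_all add: v_def V_def)
    finally show ?thesis .
  qed

  \<comment> \<open>Choice of the time scales\<close>
  obtain m :: "nat \<Rightarrow> nat" and s \<delta> :: "nat \<Rightarrow> real" where
    m: "summable (\<lambda>l. real (m l) / vK l)" "summable (\<lambda>l. \<delta> l * real (m l))" "\<delta> \<longlonglongrightarrow> 0"
    and \<delta>: "\<And>l. \<delta> l = inverse c\<^sub>E * exp (- c\<^sub>E * s l)"
    and scale: "\<forall>\<^sub>F l in sequentially.
      s l \<ge> 1 \<and> vK l > 0 \<and> s l * vK l / ln (vK l) powr (2 + \<epsilon>) \<le> real (m l)"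
  proof (rule exponential_growth_scales[OF b_growth _ c_pos])
    show "vK l \<ge> 0" for l by (simp add: vK_def)
  qed (rule that)
  have \<delta>0: "\<delta> l \<ge> 0" for l using c_pos by (simp add: \<delta>)
  have \<delta>_small: "\<forall>\<^sub>F l in sequentially. \<delta> l * (1 + 1 / c\<^sub>R\<^sub>N) < 1 / 2"
    using tendsto_mult_left_zero[OF m(3), of "1 + 1 / c\<^sub>R\<^sub>N"]
    by (rule order_tendstoD) simp
  \<comment> \<open>From index \<open>l1\<close> on, a phase starts at a positive time, so the graph
    of the preceding step confines its starting point.\<close>
  obtain l1 where l1: "T l1 > 0" using T_unbounded by blast

  \<comment> \<open>Lower bound for the visits within one phase\<close>
  define \<alpha> where "\<alpha> t = path_prob M X V t x\<^sub>0" for t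
  define g where "g l = (\<Sum>k<n l. \<alpha> (T l + k))" for l
  \<comment> \<open>The first term pays for the \<open>2 * m l\<close> times cut from the window,
    rewritten by \<open>vK_le\<close>; the second is the error of
    \<open>visits_ge_volume\<close>.\<close>
  define e where "e l = c\<^sub>R\<^sub>N * D * (real (m l) / vK l) + (1 + c\<^sub>R\<^sub>N) * (\<delta> l * real (m l))" for l
  have \<alpha>0: "\<alpha> t \<ge> 0" for t by (simp add: \<alpha>_def path_prob_nonneg)
  have lower: "\<forall>\<^sub>F l in sequentially. c\<^sub>R\<^sub>N / 2 * (real (n l) / v (T l)) \<le> g l + e l"
    using scale \<delta>_small eventually_ge_at_top[of "Suc l1"]
  proof eventually_elim
    case (elim l)
    show ?case
    proof (cases "n l = 0")
      case True
      have "e l \<ge> 0" unfolding e_def using b_pos D(1) \<delta>0[of l] elim by simp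
      then show ?thesis using True by (simp add: g_def)
    next
      case False
      define H where "H = Gt (T l)"
      define \<theta> where "\<theta> = s l * vK l / ln (vK l) powr (2 + \<epsilon>)"
      have l: "l \<ge> 1" using elim by simp
      have "T l \<ge> T l1" using elim monoD[OF T(2), of l1 l] by simp
      then have "T l > 0" using l1 by simp
      then obtain b where b: "T l = Suc b" using gr0_conv_Suc by blast
      have frozen: "Gt (T l + k) = H" if "k < n l" for k
        using a_frozen[of l "T l + k"] that T_Suc[of l] by (simp add: H_def)
      have KH: "subgraph (Klow l) H"
        using a_frozen[of l "T l"] False T_Suc[of l] by (simp add: H_def)
      \<comment> \<open>Empty phases allow \<open>i < l - 1\<close>. Monotonicity of
        \<open>Kup\<close> still places \<open>V b\<close>, and so the chain at time
        \<open>T l\<close>, inside \<open>Kup (l - 1)\<close>, where the exit laws are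
        comparable.\<close>
      obtain i where i: "i < l" "T i \<le> b" "b < T (Suc i)" using phase[of b l] b by auto
      have "V b \<subseteq> verts (Kup i)"
        using a_frozen[OF i(2,3)] by (auto simp: V_def subgraph_def)
      also have "\<dots> \<subseteq> verts (Kup (l - 1))" using i(1) by (intro Kup_mono) simp
      finally have Vb: "V b \<subseteq> verts (Kup (l - 1))" .
      have Kl: "verts (Kup (l - 1)) \<subseteq> verts (Klow l)"
        using a_nested(1)[OF l] by (simp add: subgraph_def)
      have KG: "verts (Klow l) \<subseteq> verts G" using Klow(1) by (simp add: subgraph_def)
      have tail: "measure (P u) {\<omega> \<in> space (P u).
          ereal_of_enat (hitting_time (inner_boundary G (Klow l)) (\<lambda>t. Y t \<omega>)) > ereal \<theta>} \<le> \<delta> l"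
        if u: "u \<in> verts (Klow l)" for u
      proof -
        define q where "q x = measure (P x) {\<omega> \<in> space (P x). ereal_of_enat (\<tau> l \<omega>) > ereal \<theta>}" for x
        have "q x \<le> 1" if "x \<in> verts (Klow l)" for x
          using P[of x] that KG prob_space.prob_le_1 unfolding q_def markov_chain_from_def by blast
        then have "q u \<le> (SUP x\<in>verts (Klow l). q x)"
          using u by (intro cSUP_upper bdd_aboveI2[where M = 1])
        also have "\<dots> < \<delta> l"
          using c_tail[of "s l" l] elim unfolding q_def \<theta>_def \<delta> by simp
        finally show ?thesis by (simp add: q_def \<tau>_def)
      qed
      have "c\<^sub>R\<^sub>N / 2 * ((real (n l) - 2 * real (m l)) / v (T l)) - (1 + c\<^sub>R\<^sub>N) * \<delta> l * real (m l)
          \<le> finite_markov_kernel.visits (verts H) (srw_step H) x\<^sub>0 (n l) y" if y: "y \<in> V b" for y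
        unfolding v_def H_def[symmetric]
      proof (rule visits_ge_volume[where P = P and Y = Y and S = "verts G" and \<theta> = \<theta>])
        show "wf_graph G" "subgraph (Klow l) H" "edges_induced (Klow l) G" by fact+
        show "subgraph H G" "lazy_finite_graph H" unfolding H_def by (rule sub_G lazy)+
        show "x\<^sub>0 \<in> verts (Klow l)" "y \<in> verts (Klow l)" using x0_V[of b] y Vb Kl by auto
        show "markov_chain_from (P u) Y (verts G) (\<lambda>_. srw_step G) u" if "u \<in> verts (Klow l)" for u
          using P that KG by blast
        show "\<theta> \<le> real (m l)" using elim by (simp add: \<theta>_def)
        show "c\<^sub>R\<^sub>N * measure (P x\<^sub>0) {\<omega> \<in> space (P x\<^sub>0).
              \<exists>t. hitting_time (inner_boundary G (Klow l)) (\<lambda>t. Y t \<omega>) = enat t \<and> Y t \<omega> = z}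
            \<le> measure (P y) {\<omega> \<in> space (P y).
              \<exists>t. hitting_time (inner_boundary G (Klow l)) (\<lambda>t. Y t \<omega>) = enat t \<and> Y t \<omega> = z}"
          if "z \<in> inner_boundary G (Klow l)" for z
          \<comment> \<open>This order of the pair puts the constant before the law from
            \<open>x\<^sub>0\<close>, the start whose visits are known.\<close>
          using b_ratio[OF l _ _ that, of y x\<^sub>0] x0_V[of b] y Vb by (auto simp: \<tau>_def)
      qed (use tail elim b_pos in auto)
      then have "c\<^sub>R\<^sub>N / 2 * ((real (n l) - 2 * real (m l)) / v (T l)) - (1 + c\<^sub>R\<^sub>N) * \<delta> l * real (m l)
          \<le> (\<Sum>k<n l. path_prob M X V (Suc b + k) x\<^sub>0)"
      proof (intro phase_visits_ge[OF X, where U = "verts H" and q = "srw_step H"])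
        show "finite_markov_kernel (verts H) (srw_step H)"
          unfolding H_def using lazy_finite_graph.kernel[OF lazy] .
        show "(\<Sum>y\<in>V t. srw_step (Gt t) x y) = 1" if "x \<in> V t" for t x
          using finite_markov_kernel.stochastic[OF lazy_finite_graph.kernel[OF lazy]] that by (simp add: V_def)
        show "srw_step (Gt t) x y = 0" if "y \<notin> V t" for t x y
          using lazy_finite_graph.srw_step_outside[OF lazy] that by (simp add: V_def)
        show "V (Suc b + k) = verts H \<and> srw_step (Gt (Suc b + k)) = srw_step H" if "k < n l" for k
          using frozen[OF that] b by (simp add: V_def)
        show "x\<^sub>0 \<in> verts H" using x0_V[of "T l"] by (simp add: H_def V_def)
      qed (use False V x0_V in auto)
      then have "c\<^sub>R\<^sub>N / 2 * ((real (n l) - 2 * real (m l)) / v (T l)) - (1 + c\<^sub>R\<^sub>N) * \<delta> l * real (m l) \<le> g l"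
        by (simp add: g_def \<alpha>_def b)
      moreover have "c\<^sub>R\<^sub>N / 2 * ((real (n l) - 2 * real (m l)) / v (T l))
          = c\<^sub>R\<^sub>N / 2 * (real (n l) / v (T l)) - c\<^sub>R\<^sub>N * (real (m l) / v (T l))"
        using v_ge_1[of "T l"] by (simp add: field_simps)
      moreover have "real (m l) / v (T l) \<le> D * (real (m l) / vK l)"
      proof -
        have "real (m l) * vK l \<le> real (m l) * (D * v (T l))"
          using vK_le[of l] False by (intro mult_left_mono) auto
        then show ?thesis using elim v_ge_1[of "T l"] by (simp add: field_simps)
      qed
      then have "c\<^sub>R\<^sub>N * (real (m l) / v (T l)) \<le> c\<^sub>R\<^sub>N * (D * (real (m l) / vK l))"
        using b_pos by (intro mult_left_mono) auto
      ultimately show ?thesis unfolding e_def by (simp add: algebra_simps)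
    qed
  qed

  \<comment> \<open>Expected visits and summation over the phases\<close>
  have [measurable]: "Measurable.pred M (\<lambda>\<omega>. X t \<omega> = u)" for t u
    using markov_chain_from_measurable[OF X, of t "{u}"] by simp
  have "(\<integral>\<^sup>+ \<omega>. num_visits x\<^sub>0 (\<lambda>t. X t \<omega>) \<partial>M) = (\<Sum>t. \<integral>\<^sup>+ \<omega>. (if X t \<omega> = x\<^sub>0 then 1 else 0) \<partial>M)"
    unfolding num_visits_def by (rule nn_integral_suminf) measurable
  also have "\<dots> = (\<Sum>t. ennreal (measure M {\<omega> \<in> space M. X t \<omega> = x\<^sub>0}))"
  proof (rule suminf_cong)
    fix t
    have "(\<integral>\<^sup>+ \<omega>. (if X t \<omega> = x\<^sub>0 then 1 else 0) \<partial>M) = (\<integral>\<^sup>+ \<omega>. indicator {\<omega> \<in> space M. X t \<omega> = x\<^sub>0} \<omega> \<partial>M)"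
      by (intro nn_integral_cong) auto
    then show "(\<integral>\<^sup>+ \<omega>. (if X t \<omega> = x\<^sub>0 then 1 else 0) \<partial>M) = ennreal (measure M {\<omega> \<in> space M. X t \<omega> = x\<^sub>0})"
      by (simp add: M.emeasure_eq_measure)
  qed
  finally have "summable (\<lambda>t. measure M {\<omega> \<in> space M. X t \<omega> = x\<^sub>0})"
    using not_rec by (intro summable_suminf_not_top) (auto simp: weakly_recurrent_def)
  \<comment> \<open>\<open>\<alpha>\<close> also requires the earlier positions to lie in the sets
    \<open>V s\<close>, so it is a lower bound for the visit probability, which is the direction
    used.\<close>
  moreover have "\<alpha> t \<le> measure M {\<omega> \<in> space M. X t \<omega> = x\<^sub>0}" for t
    unfolding \<alpha>_def path_prob_def by (intro M.finite_measure_mono) auto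
  ultimately have \<alpha>_summable: "summable \<alpha>"
    using \<alpha>0 by (intro summable_comparison_test[of \<alpha>]) auto
  have "summable g"
  proof (rule summableI_nonneg_bounded)
    show "g l \<ge> 0" for l unfolding g_def by (intro sum_nonneg \<alpha>0)
    \<comment> \<open>By \<open>group\<close>, the first \<open>N\<close> phases together make up
      exactly the times below \<open>T N\<close>.\<close>
    show "(\<Sum>l<N. g l) \<le> suminf \<alpha>" for N
      unfolding g_def group by (intro sum_le_suminf \<alpha>_summable) (auto simp: \<alpha>0)
  qed
  moreover have "summable e"
    unfolding e_def by (intro summable_add summable_mult m)
  ultimately have "summable (\<lambda>l. g l + e l)" by (rule summable_add)
  then have "summable (\<lambda>l. c\<^sub>R\<^sub>N / 2 * (real (n l) / v (T l)))"
  proof (rule summable_comparison_test_ev[rotated])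
    have "norm (c\<^sub>R\<^sub>N / 2 * (real (n l) / v (T l))) = c\<^sub>R\<^sub>N / 2 * (real (n l) / v (T l))" for l
      using b_pos v_ge_1[of "T l"] by simp
    then show "\<forall>\<^sub>F l in sequentially. norm (c\<^sub>R\<^sub>N / 2 * (real (n l) / v (T l))) \<le> g l + e l"
      using lower by simp
  qed
  then show False using ratio_not_summable b_pos unfolding summable_cmult_iff by simp
qed

end
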